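(* Let $G$ be a finite group and $\xi$ a linear character of $G$. Then $$\tfrac12 n_C+n_\xi=\tfrac12 n^{C,\xi}\qquad\text{and}\qquad n_R-2n_\xi=n^{R,\xi}.$$
   Context: For conjugacy classes $C$ of $G$ let $C^{-1}=\{c^{-1}\mid c\in C\}$. $n_C$ = number of conjugacy classes with $C\neq C^{-1}$; $n_\xi$ = number of conjugacy classes with $C=C^{-1}$ and $\xi\equiv-1$ on $C$; $n_{**}=|\{C_g\cup C_{g^{-1}}\mid g\in G\}|$ and $n_R=n_{**}-\frac12n_C$ (the number of classes with $C=C^{-1}$); $n^{R,\xi}$ = number of irreducible characters $\chi$ with $\chi=\bar\chi\otimes\xi$; $n^{C,\xi}$ = number of irreducible characters $\chi$ with $\chi\neq\bar\chi\otimes\xi$. Here $\bar\chi\otimes\xi$ is $g\mapsto\overline{\chi(g)}\xi(g)$. *)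

theory Defs
  imports "HOL-Algebra.Group" "Jordan_Normal_Form.Matrix" Complex_Main
begin

definition conj_class :: "('g, 'b) monoid_scheme \<Rightarrow> 'g \<Rightarrow> 'g set" where
  "conj_class G g = {inv\<^bsub>G\<^esub> x \<otimes>\<^bsub>G\<^esub> g \<otimes>\<^bsub>G\<^esub> x | x. x \<in> carrier G}"

definition conj_classes :: "('g, 'b) monoid_scheme \<Rightarrow> 'g set set" where
  "conj_classes G = conj_class G ` carrier G"

definition inv_set :: "('g, 'b) monoid_scheme \<Rightarrow> 'g set \<Rightarrow> 'g set" where
  "inv_set G C = (\<lambda>c. inv\<^bsub>G\<^esub> c) ` C"

definition n_C :: "('g, 'b) monoid_scheme \<Rightarrow> nat" where
  "n_C G = card {C \<in> conj_classes G. C \<noteq> inv_set G C}"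

definition n_xi :: "('g, 'b) monoid_scheme \<Rightarrow> ('g \<Rightarrow> complex) \<Rightarrow> nat" where
  "n_xi G \<xi> = card {C \<in> conj_classes G. C = inv_set G C \<and> (\<forall>c\<in>C. \<xi> c = -1)}"

definition n_starstar :: "('g, 'b) monoid_scheme \<Rightarrow> nat" where
  "n_starstar G = card {conj_class G g \<union> conj_class G (inv\<^bsub>G\<^esub> g) | g. g \<in> carrier G}"

definition n_R :: "('g, 'b) monoid_scheme \<Rightarrow> real" where
  "n_R G = real (n_starstar G) - real (n_C G) / 2"

definition mat_trace :: "complex mat \<Rightarrow> complex" where
  "mat_trace A = (\<Sum>i<dim_row A. A $$ (i, i))"

definition is_rep :: "('g, 'b) monoid_scheme \<Rightarrow> nat \<Rightarrow> ('g \<Rightarrow> complex mat) \<Rightarrow> bool" where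
  "is_rep G n \<rho> \<longleftrightarrow>
     (\<forall>g\<in>carrier G. \<rho> g \<in> carrier_mat n n) \<and>
     \<rho> \<one>\<^bsub>G\<^esub> = 1\<^sub>m n \<and>
     (\<forall>g\<in>carrier G. \<forall>h\<in>carrier G. \<rho> (g \<otimes>\<^bsub>G\<^esub> h) = \<rho> g * \<rho> h)"

definition is_subspace :: "nat \<Rightarrow> complex vec set \<Rightarrow> bool" where
  "is_subspace n W \<longleftrightarrow> W \<subseteq> carrier_vec n \<and> 0\<^sub>v n \<in> W \<and>
     (\<forall>v\<in>W. \<forall>w\<in>W. v + w \<in> W) \<and> (\<forall>c. \<forall>v\<in>W. c \<cdot>\<^sub>v v \<in> W)"

definition irreducible_rep :: "('g, 'b) monoid_scheme \<Rightarrow> nat \<Rightarrow> ('g \<Rightarrow> complex mat) \<Rightarrow> bool" where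
  "irreducible_rep G n \<rho> \<longleftrightarrow> is_rep G n \<rho> \<and> n > 0 \<and>
     (\<forall>W. is_subspace n W \<and> (\<forall>g\<in>carrier G. \<forall>w\<in>W. \<rho> g *\<^sub>v w \<in> W)
          \<longrightarrow> W = {0\<^sub>v n} \<or> W = carrier_vec n)"

definition character :: "('g, 'b) monoid_scheme \<Rightarrow> ('g \<Rightarrow> complex mat) \<Rightarrow> 'g \<Rightarrow> complex" where
  "character G \<rho> = (\<lambda>g. if g \<in> carrier G then mat_trace (\<rho> g) else 0)"

definition Irr :: "('g, 'b) monoid_scheme \<Rightarrow> ('g \<Rightarrow> complex) set" where
  "Irr G = {character G \<rho> | n \<rho>. irreducible_rep G n \<rho>}"

definition linear_character :: "('g, 'b) monoid_scheme \<Rightarrow> ('g \<Rightarrow> complex) \<Rightarrow> bool" where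
  "linear_character G \<xi> \<longleftrightarrow> (\<forall>g\<in>carrier G. \<xi> g \<noteq> 0) \<and>
     (\<forall>g\<in>carrier G. \<forall>h\<in>carrier G. \<xi> (g \<otimes>\<^bsub>G\<^esub> h) = \<xi> g * \<xi> h)"

definition self_dual_xi :: "('g, 'b) monoid_scheme \<Rightarrow> ('g \<Rightarrow> complex) \<Rightarrow> ('g \<Rightarrow> complex) \<Rightarrow> bool" where
  "self_dual_xi G \<xi> \<chi> \<longleftrightarrow> (\<forall>g\<in>carrier G. \<chi> g = cnj (\<chi> g) * \<xi> g)"

definition n_R_xi :: "('g, 'b) monoid_scheme \<Rightarrow> ('g \<Rightarrow> complex) \<Rightarrow> nat" where
  "n_R_xi G \<xi> = card {\<chi> \<in> Irr G. self_dual_xi G \<xi> \<chi>}"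

definition n_C_xi :: "('g, 'b) monoid_scheme \<Rightarrow> ('g \<Rightarrow> complex) \<Rightarrow> nat" where
  "n_C_xi G \<xi> = card {\<chi> \<in> Irr G. \<not> self_dual_xi G \<xi> \<chi>}"

end

theory Submission
  imports Defs "Jordan_Normal_Form.Spectral_Radius"
begin

text \<open>
  By Schur's lemma the irreducible characters are orthonormal, and
  \<open>\<chi>(1) * sum_h \<chi>(h g h\<^sup>-\<^sup>1 k) = |G| \<chi>(g) \<chi>(k)\<close> for irreducible \<open>\<chi>\<close>. Summing over \<open>\<chi>\<close>
  with the decomposition of the regular character turns this into column orthogonality.
  The map \<open>\<chi> \<mapsto> cnj \<chi> * \<xi>\<close> permutes the irreducible characters, so the number of its fixed points is the
  sum of the inner products of \<open>\<chi>\<close> with its image; by column orthogonality and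
  \<open>\<chi>(g\<^sup>-\<^sup>1) = cnj (\<chi>(g))\<close> this is the sum of the values of \<open>\<xi>\<close>, all \<open>1\<close> or \<open>-1\<close>, on the
  real conjugacy classes. The other identity follows since there are as many irreducible
  characters as classes.
\<close>

section \<open>Complex matrices\<close>

text \<open>Row orthogonality pairs \<open>\<chi> g\<close> with \<open>\<psi> (inv g)\<close>,
  which makes it a direct consequence of Schur's lemma; the link between inverses and complex
  conjugation is confined to \<open>Irr_inv\<close>. Column orthogonality is usually read off from
  the square character table, which presupposes as many irreducible characters as classes. Here the
  order is reversed: the column relation comes from the regular character, and the equality of the
  two counts is a consequence. For the regular character only composition factors matter, since an
  invariant subspace gives block triangular matrices and the trace adds over the diagonal blocks. An
  irreducible character occurs in the regular one with multiplicity equal to its degree, which also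
  shows that \<open>Irr G\<close> is finite. Both counting results are sums over the group of
  numbers of conjugators, taken to \<open>g\<close> for the number of classes and to
  \<open>inv g\<close> for the real classes. The factor 2 before \<open>n_xi\<close> arises because
  a real class on which \<open>\<xi>\<close> is -1 contributes -1 = 1 - 2 instead of 1.\<close>

lemma mult_mat_index:
  fixes A B :: "complex mat"
  assumes "A \<in> carrier_mat n m" "B \<in> carrier_mat m k" "i < n" "j < k"
  shows "(A * B) $$ (i, j) = (\<Sum>l<m. A $$ (i, l) * B $$ (l, j))"
  using assms by (auto simp: scalar_prod_def atLeast0LessThan intro!: sum.cong)

lemma mult_mat_vec_index:
  fixes A :: "complex mat"
  assumes "A \<in> carrier_mat n m" "v \<in> carrier_vec m" "i < n"
  shows "(A *\<^sub>v v) $ i = (\<Sum>l<m. A $$ (i, l) * v $ l)"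
  using assms by (auto simp: scalar_prod_def atLeast0LessThan intro!: sum.cong)

lemma mult_mat_unit_vec:
  fixes A :: "complex mat"
  shows "A \<in> carrier_mat n m \<Longrightarrow> j < m \<Longrightarrow> A *\<^sub>v unit_vec m j = col A j"
  by (intro eq_vecI) auto

lemma mat_trace_mult_comm:
  assumes A: "A \<in> carrier_mat n m" and B: "B \<in> carrier_mat m n"
  shows "mat_trace (A * B) = mat_trace (B * A)"
proof -
  have "mat_trace (A * B) = (\<Sum>i<n. \<Sum>l<m. A $$ (i, l) * B $$ (l, i))"
    using assms unfolding mat_trace_def by (auto simp: mult_mat_index[OF A B] simp del: index_mult_mat(1))
  also have "\<dots> = (\<Sum>l<m. \<Sum>i<n. B $$ (l, i) * A $$ (i, l))"
    by (subst sum.swap) (simp add: mult.commute)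
  also have "\<dots> = mat_trace (B * A)"
    using assms unfolding mat_trace_def by (auto simp: mult_mat_index[OF B A] simp del: index_mult_mat(1))
  finally show ?thesis .
qed

text \<open>\<open>P\<close> and \<open>Q\<close> may be rectangular, so that traces can be compared
  along an isomorphism of representations whose sizes are not yet known to agree.\<close>

lemma mat_trace_conj:
  assumes "P \<in> carrier_mat n m" "Q \<in> carrier_mat m n" "A \<in> carrier_mat m m" "Q * P = 1\<^sub>m m"
  shows "mat_trace (P * A * Q) = mat_trace A"
proof -
  have "mat_trace (P * A * Q) = mat_trace (Q * (P * A))"
    using assms by (intro mat_trace_mult_comm[of _ n m]) auto
  also have "Q * (P * A) = A"
    using assoc_mult_mat[OF assms(2,1,3)] assms(3,4) by simp
  finally show ?thesis .
qed

lemma mat_trace_one: "mat_trace (1\<^sub>m n) = of_nat n"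
  by (simp add: mat_trace_def)

lemma mat_trace_smult: "A \<in> carrier_mat n n \<Longrightarrow> mat_trace (c \<cdot>\<^sub>m A) = c * mat_trace A"
  by (auto simp: mat_trace_def sum_distrib_left)

text \<open>Matrices of a given size form no type, so the generic \<open>sum\<close> does not apply to them.\<close>
definition mat_sum :: "nat \<Rightarrow> nat \<Rightarrow> ('i \<Rightarrow> complex mat) \<Rightarrow> 'i set \<Rightarrow> complex mat" where
  "mat_sum n m f S = mat n m (\<lambda>(i, j). \<Sum>g\<in>S. f g $$ (i, j))"

lemma mat_sum_carrier [simp]: "mat_sum n m f S \<in> carrier_mat n m"
  and mat_sum_dim [simp]: "dim_row (mat_sum n m f S) = n" "dim_col (mat_sum n m f S) = m"
  and mat_sum_index [simp]:
    "i < n \<Longrightarrow> j < m \<Longrightarrow> mat_sum n m f S $$ (i, j) = (\<Sum>g\<in>S. f g $$ (i, j))"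
  by (auto simp: mat_sum_def)

lemma mult_mat_sum:
  assumes A: "A \<in> carrier_mat k n" and f: "\<And>g. g \<in> S \<Longrightarrow> f g \<in> carrier_mat n m"
  shows "A * mat_sum n m f S = mat_sum k m (\<lambda>g. A * f g) S"
proof (rule eq_matI)
  fix i j assume "i < dim_row (mat_sum k m (\<lambda>g. A * f g) S)" "j < dim_col (mat_sum k m (\<lambda>g. A * f g) S)"
  then have ij: "i < k" "j < m" by auto
  have "(A * mat_sum n m f S) $$ (i, j) = (\<Sum>l<n. \<Sum>g\<in>S. A $$ (i, l) * f g $$ (l, j))"
    using ij by (simp add: mult_mat_index[OF A mat_sum_carrier] sum_distrib_left del: index_mult_mat(1))
  also have "\<dots> = (\<Sum>g\<in>S. (A * f g) $$ (i, j))"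
    by (subst sum.swap) (simp add: mult_mat_index[OF A f ij] del: index_mult_mat(1))
  finally show "(A * mat_sum n m f S) $$ (i, j) = mat_sum k m (\<lambda>g. A * f g) S $$ (i, j)"
    using ij by simp
qed (use A in auto)

lemma mat_sum_mult:
  assumes A: "A \<in> carrier_mat m k" and f: "\<And>g. g \<in> S \<Longrightarrow> f g \<in> carrier_mat n m"
  shows "mat_sum n m f S * A = mat_sum n k (\<lambda>g. f g * A) S"
proof (rule eq_matI)
  fix i j assume "i < dim_row (mat_sum n k (\<lambda>g. f g * A) S)" "j < dim_col (mat_sum n k (\<lambda>g. f g * A) S)"
  then have ij: "i < n" "j < k" by auto
  have "(mat_sum n m f S * A) $$ (i, j) = (\<Sum>l<m. \<Sum>g\<in>S. f g $$ (i, l) * A $$ (l, j))"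
    using ij by (simp add: mult_mat_index[OF mat_sum_carrier A] sum_distrib_right del: index_mult_mat(1))
  also have "\<dots> = (\<Sum>g\<in>S. (f g * A) $$ (i, j))"
    by (subst sum.swap) (simp add: mult_mat_index[OF f A ij] del: index_mult_mat(1))
  finally show "(mat_sum n m f S * A) $$ (i, j) = mat_sum n k (\<lambda>g. f g * A) S $$ (i, j)"
    using ij by simp
qed (use A in auto)

lemma mat_sum_reindex:
  assumes "bij_betw \<phi> S T"
  shows "mat_sum n m f T = mat_sum n m (\<lambda>g. f (\<phi> g)) S"
  by (rule eq_matI) (auto simp: sum.reindex_bij_betw[OF assms, symmetric])

lemma mat_sum_cong:
  "(\<And>g. g \<in> S \<Longrightarrow> f g = f' g) \<Longrightarrow> mat_sum n m f S = mat_sum n m f' S"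
  by (auto simp: mat_sum_def intro!: cong_mat)

lemma mat_trace_mat_sum:
  assumes "\<And>g. g \<in> S \<Longrightarrow> f g \<in> carrier_mat n n"
  shows "mat_trace (mat_sum n n f S) = (\<Sum>g\<in>S. mat_trace (f g))"
proof -
  have "mat_trace (mat_sum n n f S) = (\<Sum>g\<in>S. \<Sum>i<n. f g $$ (i, i))"
    unfolding mat_trace_def by (simp add: sum.swap[of _ S])
  then show ?thesis using assms by (auto simp: mat_trace_def intro!: sum.cong)
qed

section \<open>Invertible matrices and bases adapted to a subspace\<close>

lemma trivial_kernel_imp_inverse:
  fixes A :: "complex mat"
  assumes A: "A \<in> carrier_mat n n"
    and ker: "\<And>v. v \<in> carrier_vec n \<Longrightarrow> A *\<^sub>v v = 0\<^sub>v n \<Longrightarrow> v = 0\<^sub>v n"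
  obtains B where "B \<in> carrier_mat n n" "A * B = 1\<^sub>m n" "B * A = 1\<^sub>m n"
proof -
  have "det A \<noteq> 0" using ker det_0_iff_vec_prod_zero[OF A] by blast
  from det_non_zero_imp_unit[OF A this, of "()"] that show ?thesis
    by (auto simp: Units_def ring_mat_def)
qed

text \<open>\<open>P *\<^sub>v u\<close> combines the columns of \<open>P\<close> with coefficients
  \<open>u\<close>. Its partial sums stay in \<open>W\<close>: a column with nonzero coefficient
  lies in \<open>W\<close>, any other adds nothing.\<close>

lemma subspace_mult_mat_vec:
  assumes W: "is_subspace n W" and P: "P \<in> carrier_mat n m" and u: "u \<in> carrier_vec m"
    and cols: "\<And>i. i < m \<Longrightarrow> u $ i \<noteq> 0 \<Longrightarrow> col P i \<in> W"
  shows "P *\<^sub>v u \<in> W"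
proof -
  have "vec n (\<lambda>i. \<Sum>j<k. P $$ (i, j) * u $ j) \<in> W" if "k \<le> m" for k
    using that
  proof (induction k)
    case 0
    have "vec n (\<lambda>i. 0) = (0\<^sub>v n :: complex vec)" by auto
    then show ?case using W by (simp add: is_subspace_def)
  next
    case (Suc k)
    let ?v = "\<lambda>k. vec n (\<lambda>i. \<Sum>j<k. P $$ (i, j) * u $ j)"
    show ?case
    proof (cases "u $ k = 0")
      case True
      then show ?thesis using Suc by simp
    next
      case False
      then have "col P k \<in> W" using cols Suc by auto
      then have "?v k + u $ k \<cdot>\<^sub>v col P k \<in> W"
        using W Suc unfolding is_subspace_def by auto
      also have "?v k + u $ k \<cdot>\<^sub>v col P k = ?v (Suc k)"
        using P Suc by (intro eq_vecI) auto
      finally show ?thesis .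
    qed
  qed
  moreover have "P *\<^sub>v u = vec n (\<lambda>i. \<Sum>j<m. P $$ (i, j) * u $ j)"
    using P u by (intro eq_vecI) (auto simp: mult_mat_vec_index[OF P u] simp del: index_mult_mat_vec)
  ultimately show ?thesis by simp
qed

text \<open>Exchange step: a new vector \<open>P u\<close> of the subspace can be made the next basis vector.\<close>
lemma extend_adapted_basis:
  fixes P Q :: "complex mat"
  assumes P: "P \<in> carrier_mat n n" "Q \<in> carrier_mat n n" "Q * P = 1\<^sub>m n"
    and u: "u \<in> carrier_vec n" and r: "r \<le> j" "j < n" and uj: "u $ j \<noteq> 0"
  obtains P' Q' where "P' \<in> carrier_mat n n" "Q' \<in> carrier_mat n n" "P' * Q' = 1\<^sub>m n" "Q' * P' = 1\<^sub>m n"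
    "\<forall>i<r. col P' i = col P i" "col P' r = P *\<^sub>v u"
proof -
  \<comment> \<open>\<open>E\<close> has \<open>u\<close> as column \<open>r\<close> and, if
    \<open>j\<close> differs from \<open>r\<close>, the unit vector \<open>r\<close> as column
    \<open>j\<close>; the other columns are those of the identity. The old basis vector
    \<open>r\<close> thus moves to position \<open>j\<close>, and the vector dropped is the one that
    \<open>u\<close> can replace because \<open>u $ j\<close> is nonzero.\<close>
  define \<tau> where "\<tau> = transpose r j"
  define E where "E = mat n n (\<lambda>(a, b). if b = r then u $ a else if a = \<tau> b then 1 else 0)"
  have E: "E \<in> carrier_mat n n" by (simp add: E_def)
  have ker: "v = 0\<^sub>v n" if v: "v \<in> carrier_vec n" and Ev: "E *\<^sub>v v = 0\<^sub>v n" for v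
  proof -
    have \<tau>: "\<tau> (\<tau> a) = a" for a by (simp add: \<tau>_def)
    \<comment> \<open>Row \<open>a\<close> of \<open>E\<close> has entries only in column
      \<open>r\<close> and in column \<open>\<tau> a\<close>, and these two columns may
      coincide.\<close>
    have coord: "0 = u $ a * v $ r + (if \<tau> a = r then 0 else v $ (\<tau> a))" if a: "a < n" for a
    proof -
      have \<tau>a: "\<tau> a < n" using a r by (auto simp: \<tau>_def transpose_def)
      have "0 = (E *\<^sub>v v) $ a" using Ev a by simp
      also have "\<dots> = (\<Sum>b<n. E $$ (a, b) * v $ b)"
        by (rule mult_mat_vec_index[OF E v a])
      also have "\<dots> = (\<Sum>b<n. (if b = r then u $ a * v $ r else 0)
                             + (if b = \<tau> a then if \<tau> a = r then 0 else v $ (\<tau> a) else 0))"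
        using a \<tau> by (intro sum.cong) (auto simp: E_def)
      also have "\<dots> = u $ a * v $ r + (if \<tau> a = r then 0 else v $ (\<tau> a))"
        using r \<tau>a by (simp add: sum.distrib)
      finally show ?thesis .
    qed
    \<comment> \<open>Since \<open>\<tau> j = r\<close>, row \<open>j\<close> reads
      \<open>u $ j * v $ r = 0\<close>. With \<open>v $ r\<close> gone, each remaining row isolates
      one other coordinate.\<close>
    have vr: "v $ r = 0" using coord[of j] r uj by (simp add: \<tau>_def)
    have "v $ b = 0" if b: "b < n" for b
    proof (cases "b = r")
      case False
      have "\<tau> b < n" using b r by (auto simp: \<tau>_def transpose_def)
      then show ?thesis using coord[of "\<tau> b"] \<tau> vr False by simp
    qed (use vr in simp)
    then show ?thesis using v by (intro eq_vecI) auto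
  qed
  have "v = 0\<^sub>v n" if v: "v \<in> carrier_vec n" and PEv: "(P * E) *\<^sub>v v = 0\<^sub>v n" for v
  proof (rule ker[OF v])
    have "E *\<^sub>v v \<in> carrier_vec n" using E v by auto
    then have "E *\<^sub>v v = (Q * P) *\<^sub>v (E *\<^sub>v v)" using P(3) by simp
    also have "\<dots> = Q *\<^sub>v (P *\<^sub>v (E *\<^sub>v v))"
      using P E v by (intro assoc_mult_mat_vec[of _ n n _ n]) auto
    also have "P *\<^sub>v (E *\<^sub>v v) = (P * E) *\<^sub>v v"
      using P E v by (intro assoc_mult_mat_vec[of _ n n _ n, symmetric]) auto
    also have "(P * E) *\<^sub>v v = 0\<^sub>v n" by (rule PEv)
    also have "Q *\<^sub>v 0\<^sub>v n = 0\<^sub>v n" using P by auto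
    finally show "E *\<^sub>v v = 0\<^sub>v n" .
  qed
  with mult_carrier_mat[OF P(1) E]
  obtain Q' where Q': "Q' \<in> carrier_mat n n" "P * E * Q' = 1\<^sub>m n" "Q' * (P * E) = 1\<^sub>m n"
    by (rule trivial_kernel_imp_inverse)
  have colE: "col (P * E) i = P *\<^sub>v col E i" if "i < n" for i
    using that P E by auto
  show ?thesis
  proof (rule that[OF _ Q'])
    show "\<forall>i<r. col (P * E) i = col P i"
    proof (intro allI impI)
      fix i assume i: "i < r"
      then have "col E i = unit_vec n i"
        using r by (intro eq_vecI) (auto simp: E_def \<tau>_def transpose_def)
      then show "col (P * E) i = col P i"
        using colE[of i] i r P by (simp add: mult_mat_unit_vec)
    qed
  next
    have "col E r = u" using r u by (intro eq_vecI) (auto simp: E_def)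
    then show "col (P * E) r = P *\<^sub>v u" using colE[of r] r by simp
  qed (use P E in auto)
qed

text \<open>The dimension of \<open>W\<close> appears as the greatest \<open>r\<close> such that
  some invertible matrix has its first \<open>r\<close> columns in \<open>W\<close>. A vector of
  \<open>W\<close> with a nonzero coordinate at or beyond \<open>r\<close> could be exchanged in as
  a further column, against maximality. The extreme values \<open>r = 0\<close> and
  \<open>r = n\<close> would make \<open>W\<close> trivial.\<close>

lemma adapted_basis:
  assumes W: "is_subspace n W" and ne: "W \<noteq> {0\<^sub>v n}" "W \<noteq> carrier_vec n"
  obtains r P Q where "0 < r" "r < n" "P \<in> carrier_mat n n" "Q \<in> carrier_mat n n"
    "P * Q = 1\<^sub>m n" "Q * P = 1\<^sub>m n" "\<And>i. i < r \<Longrightarrow> col P i \<in> W"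
    "\<And>w i. w \<in> W \<Longrightarrow> r \<le> i \<Longrightarrow> i < n \<Longrightarrow> (Q *\<^sub>v w) $ i = 0"
proof -
  define R where "R r \<longleftrightarrow> r \<le> n \<and> (\<exists>P Q. P \<in> carrier_mat n n \<and> Q \<in> carrier_mat n n \<and>
      P * Q = 1\<^sub>m n \<and> Q * P = 1\<^sub>m n \<and> (\<forall>i<r. col P i \<in> W))" for r
  have R0: "R 0" unfolding R_def by (auto intro!: exI[of _ "1\<^sub>m n"])
  define r where "r = (GREATEST r. R r)"
  have Rr: "R r" unfolding r_def by (rule GreatestI_nat[of R 0 n, OF R0]) (auto simp: R_def)
  have max: "s \<le> r" if "R s" for s
    unfolding r_def by (rule Greatest_le_nat[of R s n, OF that]) (auto simp: R_def)
  obtain P Q where P: "P \<in> carrier_mat n n" "Q \<in> carrier_mat n n" "P * Q = 1\<^sub>m n" "Q * P = 1\<^sub>m n"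
    and cols: "\<And>i. i < r \<Longrightarrow> col P i \<in> W" and rn: "r \<le> n"
    using Rr unfolding R_def by auto
  have Wc: "w \<in> carrier_vec n" if "w \<in> W" for w using W that by (auto simp: is_subspace_def)
  have PQ: "P *\<^sub>v (Q *\<^sub>v w) = w" if "w \<in> carrier_vec n" for w
    using P that assoc_mult_mat_vec[of P n n Q n w] by simp
  have coords: "(Q *\<^sub>v w) $ j = 0" if w: "w \<in> W" and j: "r \<le> j" "j < n" for w j
  proof (rule ccontr)
    assume nz: "(Q *\<^sub>v w) $ j \<noteq> 0"
    have Qw: "Q *\<^sub>v w \<in> carrier_vec n" using P Wc[OF w] by auto
    obtain P' Q' where P': "P' \<in> carrier_mat n n" "Q' \<in> carrier_mat n n" "P' * Q' = 1\<^sub>m n" "Q' * P' = 1\<^sub>m n"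
      "\<forall>i<r. col P' i = col P i" "col P' r = P *\<^sub>v (Q *\<^sub>v w)"
      by (rule extend_adapted_basis[OF P(1,2,4) Qw j nz])
    have "\<forall>i<Suc r. col P' i \<in> W"
      using P'(5,6) cols w PQ[OF Wc[OF w]] by (auto simp: less_Suc_eq)
    moreover have "Suc r \<le> n" using j by simp
    ultimately have "R (Suc r)" unfolding R_def using P'(1-4) by blast
    then show False using max by fastforce
  qed
  have "r \<noteq> n"
  proof
    assume "r = n"
    then have "w \<in> W" if "w \<in> carrier_vec n" for w
      using subspace_mult_mat_vec[OF W P(1), of "Q *\<^sub>v w"] cols PQ[OF that] P that by auto
    then show False using ne(2) Wc by blast
  qed
  moreover have "r \<noteq> 0"
  proof
    assume "r = 0"
    have "w = 0\<^sub>v n" if "w \<in> W" for w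
    proof -
      have "Q *\<^sub>v w = 0\<^sub>v n" using coords[OF that] \<open>r = 0\<close> P by (intro eq_vecI) auto
      moreover have "P *\<^sub>v 0\<^sub>v n = 0\<^sub>v n" using P by auto
      ultimately show ?thesis using PQ[OF Wc[OF that]] by metis
    qed
    moreover have "0\<^sub>v n \<in> W" using W by (simp add: is_subspace_def)
    ultimately show False using ne(1) by blast
  qed
  ultimately show ?thesis using that[OF _ _ P cols coords] rn by auto
qed

section \<open>Representations and Schur's lemma\<close>

lemma is_repD:
  assumes "is_rep G n \<rho>"
  shows "g \<in> carrier G \<Longrightarrow> \<rho> g \<in> carrier_mat n n"
    and "\<rho> \<one>\<^bsub>G\<^esub> = 1\<^sub>m n"
    and "g \<in> carrier G \<Longrightarrow> h \<in> carrier G \<Longrightarrow> \<rho> (g \<otimes>\<^bsub>G\<^esub> h) = \<rho> g * \<rho> h"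
  using assms by (auto simp: is_rep_def)

lemma irreducible_repD:
  assumes "irreducible_rep G n \<rho>"
  shows "is_rep G n \<rho>" "n > 0"
    and "is_subspace n W \<Longrightarrow> (\<And>g w. g \<in> carrier G \<Longrightarrow> w \<in> W \<Longrightarrow> \<rho> g *\<^sub>v w \<in> W)
           \<Longrightarrow> W = {0\<^sub>v n} \<or> W = carrier_vec n"
  using assms by (auto simp: irreducible_rep_def)

text \<open>The kernel of \<open>X\<close> is an invariant subspace, and it is proper as
  \<open>X\<close> is nonzero. Invariance is assumed in place of an intertwining relation, so that
  the lemma serves both Schur's lemma and the averaged form in \<open>Irr_inv\<close>, whose other
  side is not set up as a representation.\<close>

lemma kernel_invariant_trivial:
  assumes \<sigma>: "irreducible_rep G m \<sigma>" and X: "X \<in> carrier_mat n m"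
    and inv: "\<And>g v. g \<in> carrier G \<Longrightarrow> v \<in> carrier_vec m \<Longrightarrow> X *\<^sub>v v = 0\<^sub>v n \<Longrightarrow> X *\<^sub>v (\<sigma> g *\<^sub>v v) = 0\<^sub>v n"
    and nz: "X \<noteq> 0\<^sub>m n m" and v: "v \<in> carrier_vec m" "X *\<^sub>v v = 0\<^sub>v n"
  shows "v = 0\<^sub>v m"
proof -
  let ?K = "{v \<in> carrier_vec m. X *\<^sub>v v = 0\<^sub>v n}"
  have "is_subspace m ?K"
    using X by (auto simp: is_subspace_def mult_add_distrib_mat_vec[of _ n m] mult_mat_vec[of _ n m])
  then have "?K = {0\<^sub>v m} \<or> ?K = carrier_vec m"
    using inv mult_mat_vec_carrier[OF is_repD(1)[OF irreducible_repD(1)[OF \<sigma>]]]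
    by (intro irreducible_repD(3)[OF \<sigma>]) auto
  moreover have "?K \<noteq> carrier_vec m"
  proof
    assume K: "?K = carrier_vec m"
    have "X = 0\<^sub>m n m"
    proof (rule eq_matI)
      fix i j assume "i < dim_row (0\<^sub>m n m :: complex mat)" "j < dim_col (0\<^sub>m n m :: complex mat)"
      then have ij: "i < n" "j < m" by auto
      have "unit_vec m j \<in> ?K" unfolding K by simp
      then have "(X *\<^sub>v unit_vec m j) $ i = 0" using ij by simp
      then have "X $$ (i, j) = 0" using X ij by simp
      then show "X $$ (i, j) = 0\<^sub>m n m $$ (i, j)" using ij by simp
    qed (use X in auto)
    with nz show False by simp
  qed
  ultimately show ?thesis using v by auto
qed

locale finite_group = group +
  assumes finite_carrier [simp]: "finite (carrier G)"
begin

lemma rep_inv: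
  assumes "is_rep G n \<rho>" "g \<in> carrier G"
  shows "\<rho> (inv g) * \<rho> g = 1\<^sub>m n" "\<rho> g * \<rho> (inv g) = 1\<^sub>m n"
  using is_repD(2)[OF assms(1)] assms(2) by (simp_all add: is_repD(3)[OF assms(1), symmetric])

text \<open>Kernel and image of an intertwiner are invariant: irreducibility of
  \<open>\<sigma>\<close> makes \<open>X\<close> injective, that of \<open>\<rho>\<close> makes it
  surjective. The sizes \<open>n\<close> and \<open>m\<close> may differ a priori, so the two-sided
  inverse is built by hand instead of through a determinant.\<close>

lemma schur:
  assumes \<rho>: "irreducible_rep G n \<rho>" and \<sigma>: "irreducible_rep G m \<sigma>"
    and X: "X \<in> carrier_mat n m" and comm: "\<And>g. g \<in> carrier G \<Longrightarrow> \<rho> g * X = X * \<sigma> g"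
    and nz: "X \<noteq> 0\<^sub>m n m"
  obtains Y where "Y \<in> carrier_mat m n" "X * Y = 1\<^sub>m n" "Y * X = 1\<^sub>m m"
proof -
  note r = is_repD(1)[OF irreducible_repD(1)[OF \<rho>]] and s = is_repD(1)[OF irreducible_repD(1)[OF \<sigma>]]
  have comm_vec: "\<rho> g *\<^sub>v (X *\<^sub>v v) = X *\<^sub>v (\<sigma> g *\<^sub>v v)" if "g \<in> carrier G" "v \<in> carrier_vec m" for g v
    using comm[OF that(1)] assoc_mult_mat_vec[OF r[OF that(1)] X that(2)]
      assoc_mult_mat_vec[OF X s[OF that(1)] that(2)] by simp
  have ker: "v = 0\<^sub>v m" if "v \<in> carrier_vec m" "X *\<^sub>v v = 0\<^sub>v n" for v
  proof (rule kernel_invariant_trivial[OF \<sigma> X _ nz that])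
    fix g v assume "g \<in> carrier G" "v \<in> carrier_vec m" "X *\<^sub>v v = 0\<^sub>v n"
    moreover from this have "\<rho> g *\<^sub>v 0\<^sub>v n = 0\<^sub>v n" using r[of g] by auto
    ultimately show "X *\<^sub>v (\<sigma> g *\<^sub>v v) = 0\<^sub>v n" using comm_vec[of g v] by simp
  qed
  let ?I = "{X *\<^sub>v v | v. v \<in> carrier_vec m}"
  have "?I = {0\<^sub>v n} \<or> ?I = carrier_vec n"
  proof (rule irreducible_repD(3)[OF \<rho>])
    have add: "\<exists>w. X *\<^sub>v u + X *\<^sub>v v = X *\<^sub>v w \<and> w \<in> carrier_vec m"
      if "u \<in> carrier_vec m" "v \<in> carrier_vec m" for u v
      using X that by (intro exI[of _ "u + v"]) (simp add: mult_add_distrib_mat_vec[of _ n m])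
    have smult: "\<exists>w. c \<cdot>\<^sub>v (X *\<^sub>v v) = X *\<^sub>v w \<and> w \<in> carrier_vec m" if "v \<in> carrier_vec m" for c v
      using X that by (intro exI[of _ "c \<cdot>\<^sub>v v"]) (simp add: mult_mat_vec[of _ n m])
    have zero: "\<exists>w. 0\<^sub>v n = X *\<^sub>v w \<and> w \<in> carrier_vec m"
      using X by (intro exI[of _ "0\<^sub>v m"]) auto
    show "is_subspace n ?I"
      using X add smult zero unfolding is_subspace_def by auto
    show "\<rho> g *\<^sub>v w \<in> ?I" if g: "g \<in> carrier G" and "w \<in> ?I" for g w
    proof -
      obtain v where v: "v \<in> carrier_vec m" "w = X *\<^sub>v v" using \<open>w \<in> ?I\<close> by blast
      have "\<sigma> g *\<^sub>v v \<in> carrier_vec m" by (rule mult_mat_vec_carrier[OF s[OF g] v(1)])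
      then show ?thesis using comm_vec[OF g v(1)] v(2) by blast
    qed
  qed
  \<comment> \<open>If the image were zero, the unit vector 0, a nonzero vector because
    \<open>m > 0\<close>, would lie in the trivial kernel.\<close>
  moreover have "?I \<noteq> {0\<^sub>v n}"
  proof
    assume I: "?I = {0\<^sub>v n}"
    have "X *\<^sub>v unit_vec m 0 \<in> ?I" using unit_vec_carrier by blast
    then have "X *\<^sub>v unit_vec m 0 = 0\<^sub>v n" unfolding I by simp
    then have "unit_vec m 0 = (0\<^sub>v m :: complex vec)" by (intro ker) auto
    then have "unit_vec m 0 $ 0 = (0\<^sub>v m :: complex vec) $ 0" by simp
    then show False using irreducible_repD(2)[OF \<sigma>] by simp
  qed
  ultimately have surj: "?I = carrier_vec n" by blast
  have "\<exists>v. v \<in> carrier_vec m \<and> X *\<^sub>v v = unit_vec n j" for j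
  proof -
    have "unit_vec n j \<in> ?I" using surj by simp
    then show ?thesis by auto
  qed
  then obtain y where y: "y j \<in> carrier_vec m" "X *\<^sub>v y j = unit_vec n j" for j by metis
  \<comment> \<open>The columns of \<open>Y\<close> are chosen preimages of the unit vectors, which
    makes \<open>Y\<close> a right inverse.\<close>
  define Y where "Y = mat m n (\<lambda>(i, j). y j $ i)"
  have Y: "Y \<in> carrier_mat m n" by (simp add: Y_def)
  have colY: "col Y j = y j" if "j < n" for j
    using that y(1)[of j] by (intro eq_vecI) (auto simp: Y_def)
  have XY: "X * Y = 1\<^sub>m n"
  proof (rule eq_matI)
    fix i j assume "i < dim_row (1\<^sub>m n :: complex mat)" "j < dim_col (1\<^sub>m n :: complex mat)"
    then have ij: "i < n" "j < n" by auto
    have "(X * Y) $$ (i, j) = (X *\<^sub>v y j) $ i" using X Y ij colY by auto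
    then show "(X * Y) $$ (i, j) = 1\<^sub>m n $$ (i, j)" using ij y(2) by simp
  qed (use X Y in auto)
  have YX: "Y * X = 1\<^sub>m m"
  proof (rule eq_matI)
    fix i j assume "i < dim_row (1\<^sub>m m :: complex mat)" "j < dim_col (1\<^sub>m m :: complex mat)"
    then have ij: "i < m" "j < m" by auto
    let ?e = "unit_vec m j :: complex vec"
    have e: "?e \<in> carrier_vec m" by simp
    have YXc: "(Y * X) *\<^sub>v ?e = col (Y * X) j" using X Y ij by (intro mult_mat_unit_vec) auto
    have YXe: "(Y * X) *\<^sub>v ?e \<in> carrier_vec m" using X Y by auto
    have Xe: "X *\<^sub>v ?e \<in> carrier_vec n" using X by auto
    \<comment> \<open>Injectivity of \<open>X\<close> turns the right inverse into a left inverse: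
      \<open>X\<close> sends \<open>Y X e\<close> and \<open>e\<close> to the same vector.\<close>
    have "X *\<^sub>v ((Y * X) *\<^sub>v ?e) = X *\<^sub>v (Y *\<^sub>v (X *\<^sub>v ?e))"
      using assoc_mult_mat_vec[OF Y X e] by simp
    also have "\<dots> = X *\<^sub>v ?e" using assoc_mult_mat_vec[OF X Y Xe] XY Xe by simp
    finally have "X *\<^sub>v ((Y * X) *\<^sub>v ?e - ?e) = 0\<^sub>v n"
      using mult_minus_distrib_mat_vec[OF X YXe e] Xe by simp
    then have "(Y * X) *\<^sub>v ?e - ?e = 0\<^sub>v m" using YXe by (intro ker) auto
    then have "((Y * X) *\<^sub>v ?e - ?e) $ i = 0" using ij by simp
    then show "(Y * X) $$ (i, j) = 1\<^sub>m m $$ (i, j)" using ij X Y unfolding YXc by simp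
  qed (use X Y in auto)
  show ?thesis by (rule that[OF Y XY YX])
qed

text \<open>Over the complex numbers \<open>X\<close> has an eigenvalue \<open>c\<close>. Then
  \<open>X - c \<cdot>\<^sub>m 1\<^sub>m n\<close> is an intertwiner that kills an eigenvector, so
  it is not invertible and must vanish by \<open>schur\<close>.\<close>

lemma schur_scalar:
  assumes \<rho>: "irreducible_rep G n \<rho>"
    and X: "X \<in> carrier_mat n n" and comm: "\<And>g. g \<in> carrier G \<Longrightarrow> \<rho> g * X = X * \<rho> g"
  obtains c where "X = c \<cdot>\<^sub>m 1\<^sub>m n"
proof -
  note r = is_repD(1)[OF irreducible_repD(1)[OF \<rho>]]
  obtain c where "eigenvalue X c"
    using spectrum_non_empty[OF X irreducible_repD(2)[OF \<rho>]] by (auto simp: spectrum_def)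
  then obtain v where v: "v \<in> carrier_vec n" "v \<noteq> 0\<^sub>v n" "X *\<^sub>v v = c \<cdot>\<^sub>v v"
    using X by (auto simp: eigenvalue_def eigenvector_def)
  let ?Y = "X - c \<cdot>\<^sub>m 1\<^sub>m n"
  have Y: "?Y \<in> carrier_mat n n" using X by auto
  have cI: "c \<cdot>\<^sub>m 1\<^sub>m n \<in> carrier_mat n n" by auto
  have "(c \<cdot>\<^sub>m 1\<^sub>m n) *\<^sub>v v = c \<cdot>\<^sub>v v"
  proof (rule eq_vecI)
    fix i assume "i < dim_vec (c \<cdot>\<^sub>v v)"
    then have i: "i < n" using v(1) by simp
    have "((c \<cdot>\<^sub>m 1\<^sub>m n) *\<^sub>v v) $ i = (\<Sum>l<n. if l = i then c * v $ i else 0)"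
      unfolding mult_mat_vec_index[OF cI v(1) i] using i by (intro sum.cong) auto
    then show "((c \<cdot>\<^sub>m 1\<^sub>m n) *\<^sub>v v) $ i = (c \<cdot>\<^sub>v v) $ i" using i v(1) by simp
  qed (use v(1) in auto)
  then have Yv: "?Y *\<^sub>v v = 0\<^sub>v n"
    using v X by (simp add: minus_mult_distrib_mat_vec[OF X cI v(1)])
  have Ycomm: "\<rho> g * ?Y = ?Y * \<rho> g" if "g \<in> carrier G" for g
  proof -
    note rg = r[OF that]
    have "\<rho> g * ?Y = \<rho> g * X - c \<cdot>\<^sub>m \<rho> g"
      using mult_minus_distrib_mat[OF rg X cI] mult_smult_distrib[OF rg one_carrier_mat, of c] rg by simp
    moreover have "?Y * \<rho> g = X * \<rho> g - c \<cdot>\<^sub>m \<rho> g"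
      using minus_mult_distrib_mat[OF X cI rg] mult_smult_assoc_mat[OF one_carrier_mat rg, of c] rg by simp
    ultimately show ?thesis using comm[OF that] by simp
  qed
  have "?Y = 0\<^sub>m n n"
  proof (rule ccontr)
    assume "?Y \<noteq> 0\<^sub>m n n"
    from schur[OF \<rho> \<rho> Y Ycomm this] obtain Z where Z: "Z \<in> carrier_mat n n" "Z * ?Y = 1\<^sub>m n" by blast
    have "v = (Z * ?Y) *\<^sub>v v" using Z v by simp
    also have "\<dots> = Z *\<^sub>v (?Y *\<^sub>v v)" using Z Y v by (intro assoc_mult_mat_vec) auto
    also have "\<dots> = 0\<^sub>v n" using Yv Z by auto
    finally show False using v by simp
  qed
  have "X = c \<cdot>\<^sub>m 1\<^sub>m n"
  proof (rule eq_matI)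
    fix i j assume "i < dim_row (c \<cdot>\<^sub>m 1\<^sub>m n)" "j < dim_col (c \<cdot>\<^sub>m 1\<^sub>m n)"
    then have ij: "i < n" "j < n" by auto
    have "?Y $$ (i, j) = 0" using \<open>?Y = 0\<^sub>m n n\<close> ij by simp
    then show "X $$ (i, j) = (c \<cdot>\<^sub>m 1\<^sub>m n) $$ (i, j)" using ij X by simp
  qed (use X in auto)
  then show ?thesis by (rule that)
qed

section \<open>Intertwiners obtained by averaging over the group\<close>

lemma bij_mult_left: "h \<in> carrier G \<Longrightarrow> bij_betw (\<lambda>g. h \<otimes> g) (carrier G) (carrier G)"
  by (rule bij_betwI[where g = "\<lambda>g. inv h \<otimes> g"]) (auto simp: m_assoc[symmetric])

text \<open>Writing \<open>\<sigma> (inv g)\<close> as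
  \<open>\<sigma> (inv (h \<otimes> g)) * \<sigma> h\<close> and reindexing by
  \<open>h \<otimes> g\<close> moves the factor from the left to the right. Any matrix
  \<open>X\<close> thereby yields an intertwiner to which Schur's lemma applies.\<close>

lemma averaged_intertwiner:
  assumes \<rho>: "is_rep G n \<rho>" and \<sigma>: "is_rep G m \<sigma>" and X: "X \<in> carrier_mat n m" and h: "h \<in> carrier G"
  shows "\<rho> h * mat_sum n m (\<lambda>g. \<rho> g * X * \<sigma> (inv g)) (carrier G)
       = mat_sum n m (\<lambda>g. \<rho> g * X * \<sigma> (inv g)) (carrier G) * \<sigma> h" (is "_ * ?S = _")
proof -
  note r = is_repD[OF \<rho>] and s = is_repD[OF \<sigma>]
  have car: "\<rho> g * X * \<sigma> k \<in> carrier_mat n m" if "g \<in> carrier G" "k \<in> carrier G" for g k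
    by (rule mult_carrier_mat[OF mult_carrier_mat[OF r(1)[OF that(1)] X] s(1)[OF that(2)]])
  have "\<rho> h * ?S = mat_sum n m (\<lambda>g. \<rho> h * (\<rho> g * X * \<sigma> (inv g))) (carrier G)"
    by (rule mult_mat_sum[OF r(1)[OF h]]) (simp add: car)
  also have "\<dots> = mat_sum n m (\<lambda>g. \<rho> (h \<otimes> g) * X * \<sigma> (inv (h \<otimes> g)) * \<sigma> h) (carrier G)"
  proof (rule mat_sum_cong)
    fix g assume g: "g \<in> carrier G"
    have "\<sigma> (inv (h \<otimes> g)) * \<sigma> h = \<sigma> (inv g)"
      using g h by (simp add: s(3)[symmetric] inv_mult_group m_assoc)
    then have "\<rho> (h \<otimes> g) * X * \<sigma> (inv (h \<otimes> g)) * \<sigma> h = \<rho> (h \<otimes> g) * X * \<sigma> (inv g)"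
      using assoc_mult_mat[OF mult_carrier_mat[OF r(1) X] s(1) s(1)[OF h], of "h \<otimes> g" "inv (h \<otimes> g)"] g h
      by simp
    also have "\<dots> = \<rho> h * (\<rho> g * X * \<sigma> (inv g))"
    proof -
      have "\<rho> g * X \<in> carrier_mat n m" using r(1)[OF g] X by auto
      moreover have "\<rho> (h \<otimes> g) * X = \<rho> h * (\<rho> g * X)"
        using r(1)[OF g] r(1)[OF h] X r(3)[OF h g] by simp
      ultimately show ?thesis using r(1)[OF h] s(1)[of "inv g"] g by simp
    qed
    finally show "\<rho> h * (\<rho> g * X * \<sigma> (inv g)) = \<rho> (h \<otimes> g) * X * \<sigma> (inv (h \<otimes> g)) * \<sigma> h" by simp
  qed
  also have "\<dots> = mat_sum n m (\<lambda>g. \<rho> g * X * \<sigma> (inv g) * \<sigma> h) (carrier G)"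
    by (rule mat_sum_reindex[OF bij_mult_left[OF h], symmetric])
  also have "\<dots> = ?S * \<sigma> h"
    by (rule mat_sum_mult[OF s(1)[OF h], symmetric]) (simp add: car)
  finally show ?thesis .
qed

end

section \<open>Characters\<close>

lemma mat_trace_eq: "A \<in> carrier_mat n m \<Longrightarrow> mat_trace A = (\<Sum>i<n. A $$ (i, i))"
  by (auto simp: mat_trace_def)

lemma map_mat_cnj_mult:
  assumes A: "A \<in> carrier_mat n m" and B: "B \<in> carrier_mat m k"
  shows "map_mat cnj (A * B) = map_mat cnj A * map_mat cnj B"
proof (rule eq_matI)
  fix i j assume "i < dim_row (map_mat cnj A * map_mat cnj B)" "j < dim_col (map_mat cnj A * map_mat cnj B)"
  then have ij: "i < n" "j < k" using A B by auto
  have cA: "map_mat cnj A \<in> carrier_mat n m" and cB: "map_mat cnj B \<in> carrier_mat m k"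
    using A B by auto
  have "map_mat cnj (A * B) $$ (i, j) = cnj ((A * B) $$ (i, j))" using A B ij by simp
  also have "\<dots> = (map_mat cnj A * map_mat cnj B) $$ (i, j)"
    unfolding mult_mat_index[OF A B ij] mult_mat_index[OF cA cB ij] using A B ij by simp
  finally show "map_mat cnj (A * B) $$ (i, j) = (map_mat cnj A * map_mat cnj B) $$ (i, j)" .
qed (use A B in auto)

lemma map_mat_cnj_mult_vec:
  assumes A: "A \<in> carrier_mat n m" and v: "v \<in> carrier_vec m"
  shows "map_mat cnj A *\<^sub>v conjugate v = conjugate (A *\<^sub>v v)"
proof (rule eq_vecI)
  fix i assume "i < dim_vec (conjugate (A *\<^sub>v v))"
  then have i: "i < n" using A by simp
  have cA: "map_mat cnj A \<in> carrier_mat n m" and cv: "conjugate v \<in> carrier_vec m"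
    using A v by auto
  show "(map_mat cnj A *\<^sub>v conjugate v) $ i = conjugate (A *\<^sub>v v) $ i"
    using A v i unfolding mult_mat_vec_index[OF cA cv i]
    by (simp add: mult_mat_vec_index[OF A v i] del: index_mult_mat_vec)
qed (use A in auto)

definition mat_unit :: "nat \<Rightarrow> nat \<Rightarrow> nat \<Rightarrow> nat \<Rightarrow> complex mat" where
  "mat_unit n m k l = mat n m (\<lambda>(a, b). if a = k \<and> b = l then 1 else 0)"

lemma mat_unit_carrier [simp]: "mat_unit n m k l \<in> carrier_mat n m"
  by (simp add: mat_unit_def)

lemma mult_mat_unit_mult_index:
  assumes A: "A \<in> carrier_mat n n" and B: "B \<in> carrier_mat m m"
    and "i < n" "k < n" "l < m" "j < m"
  shows "(A * mat_unit n m k l * B) $$ (i, j) = A $$ (i, k) * B $$ (l, j)"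
proof -
  have AE: "(A * mat_unit n m k l) $$ (i, b) = (if b = l then A $$ (i, k) else 0)" if "b < m" for b
  proof -
    have "(A * mat_unit n m k l) $$ (i, b) = (\<Sum>a<n. if a = k then if b = l then A $$ (i, k) else 0 else 0)"
      unfolding mult_mat_index[OF A mat_unit_carrier assms(3) that]
      using assms that by (intro sum.cong) (auto simp: mat_unit_def)
    then show ?thesis using assms by simp
  qed
  have "(A * mat_unit n m k l * B) $$ (i, j) = (\<Sum>b<m. if b = l then A $$ (i, k) * B $$ (l, j) else 0)"
    unfolding mult_mat_index[OF mult_carrier_mat[OF A mat_unit_carrier] B assms(3,6)]
    by (intro sum.cong) (auto simp: AE)
  then show ?thesis using assms by simp
qed

lemma mat_trace_mat_unit:
  assumes "k < n" "l < n"
  shows "mat_trace (mat_unit n n k l) = (if k = l then 1 else 0)"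
proof -
  have "mat_trace (mat_unit n n k l) = (\<Sum>i<n. if i = k then if k = l then 1 else 0 else 0)"
    unfolding mat_trace_def by (intro sum.cong) (auto simp: mat_unit_def)
  then show ?thesis using assms by simp
qed

lemma IrrE:
  assumes "\<chi> \<in> Irr G"
  obtains n \<rho> where "irreducible_rep G n \<rho>" "\<And>g. g \<in> carrier G \<Longrightarrow> \<chi> g = mat_trace (\<rho> g)"
    "\<And>g. g \<notin> carrier G \<Longrightarrow> \<chi> g = 0"
  using assms by (auto simp: Irr_def character_def)

lemma IrrI:
  assumes "irreducible_rep G n \<rho>" "\<And>g. g \<in> carrier G \<Longrightarrow> \<chi> g = mat_trace (\<rho> g)"
    "\<And>g. g \<notin> carrier G \<Longrightarrow> \<chi> g = 0"
  shows "\<chi> \<in> Irr G"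
proof -
  have "\<chi> = character G \<rho>" using assms(2,3) by (auto simp: character_def)
  then show ?thesis using assms(1) by (auto simp: Irr_def)
qed

context finite_group
begin

lemma bij_mult_right: "h \<in> carrier G \<Longrightarrow> bij_betw (\<lambda>g. g \<otimes> h) (carrier G) (carrier G)"
  by (rule bij_betwI[where g = "\<lambda>g. g \<otimes> inv h"]) (auto simp: m_assoc)

lemma card_carrier_pos: "card (carrier G) > 0"
  by (simp add: card_gt_0_iff) (use one_closed in blast)

text \<open>The product of diagonal entries \<open>i\<close> of \<open>\<rho> g\<close> and
  \<open>j\<close> of \<open>\<sigma> (inv g)\<close> is the entry \<open>(i, j)\<close> of
  \<open>\<rho> g\<close> times a matrix unit times \<open>\<sigma> (inv g)\<close>. The pairing of
  two characters becomes a sum of entries of averaged intertwiners.\<close>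

lemma sum_trace_products:
  assumes \<rho>: "is_rep G n \<rho>" and \<sigma>: "is_rep G m \<sigma>"
  shows "(\<Sum>g\<in>carrier G. mat_trace (\<rho> g) * mat_trace (\<sigma> (inv g)))
       = (\<Sum>i<n. \<Sum>j<m. mat_sum n m (\<lambda>g. \<rho> g * mat_unit n m i j * \<sigma> (inv g)) (carrier G) $$ (i, j))"
proof -
  note r = is_repD(1)[OF \<rho>] and s = is_repD(1)[OF \<sigma>]
  have "(\<Sum>g\<in>carrier G. mat_trace (\<rho> g) * mat_trace (\<sigma> (inv g)))
      = (\<Sum>g\<in>carrier G. \<Sum>i<n. \<Sum>j<m. \<rho> g $$ (i, i) * \<sigma> (inv g) $$ (j, j))"
    by (intro sum.cong) (simp_all add: mat_trace_eq[OF r] mat_trace_eq[OF s] sum_product)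
  also have "\<dots> = (\<Sum>i<n. \<Sum>j<m. \<Sum>g\<in>carrier G. \<rho> g $$ (i, i) * \<sigma> (inv g) $$ (j, j))"
    by (subst sum.swap) (intro sum.cong refl sum.swap)
  also have "\<dots> = (\<Sum>i<n. \<Sum>j<m. mat_sum n m (\<lambda>g. \<rho> g * mat_unit n m i j * \<sigma> (inv g)) (carrier G) $$ (i, j))"
    by (intro sum.cong refl) (simp add: mult_mat_unit_mult_index[OF r s] del: index_mult_mat(1))
  finally show ?thesis .
qed

lemma conj_mat_carrier:
  assumes "is_rep G n \<rho>" "is_rep G m \<sigma>" "X \<in> carrier_mat n m" "g \<in> carrier G" "h \<in> carrier G"
  shows "\<rho> g * X * \<sigma> h \<in> carrier_mat n m"
  by (rule mult_carrier_mat[OF mult_carrier_mat[OF is_repD(1)[OF assms(1,4)] assms(3)] is_repD(1)[OF assms(2,5)]])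

text \<open>Schur's lemma makes the sum a scalar matrix. Each summand is a conjugate of
  \<open>X\<close>, so comparing traces determines the scalar.\<close>

lemma averaged_scalar:
  assumes \<rho>: "irreducible_rep G n \<rho>" and X: "X \<in> carrier_mat n n"
  shows "mat_sum n n (\<lambda>g. \<rho> g * X * \<rho> (inv g)) (carrier G)
       = (of_nat (card (carrier G)) * mat_trace X / of_nat n) \<cdot>\<^sub>m 1\<^sub>m n" (is "?S = _")
proof -
  note rep = irreducible_repD(1)[OF \<rho>]
  obtain c where c: "?S = c \<cdot>\<^sub>m 1\<^sub>m n"
    by (rule schur_scalar[OF \<rho> mat_sum_carrier averaged_intertwiner[OF rep rep X]])
  have "mat_trace ?S = (\<Sum>g\<in>carrier G. mat_trace (\<rho> g * X * \<rho> (inv g)))"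
    by (rule mat_trace_mat_sum) (simp add: conj_mat_carrier[OF rep rep X])
  also have "\<dots> = (\<Sum>g\<in>carrier G. mat_trace X)"
    by (intro sum.cong refl mat_trace_conj[of _ n n])
       (simp_all add: is_repD(1)[OF rep] X rep_inv[OF rep])
  finally have "c * of_nat n = of_nat (card (carrier G)) * mat_trace X"
    unfolding c by (simp add: mat_trace_smult[of _ n] mat_trace_one)
  then have "c = of_nat (card (carrier G)) * mat_trace X / of_nat n"
    using irreducible_repD(2)[OF \<rho>] by (simp add: field_simps)
  with c show ?thesis by simp
qed

text \<open>Equal characters may be computed from one and the same representation, where
  \<open>averaged_scalar\<close> gives every entry. For distinct characters every averaged
  intertwiner vanishes, since an invertible one would equate the traces.\<close>

lemma character_orthogonality:
  assumes "\<chi> \<in> Irr G" "\<psi> \<in> Irr G"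
  shows "(\<Sum>g\<in>carrier G. \<chi> g * \<psi> (inv g)) = (if \<chi> = \<psi> then of_nat (card (carrier G)) else 0)"
proof -
  obtain n \<rho> where \<rho>: "irreducible_rep G n \<rho>" and \<chi>: "\<And>g. g \<in> carrier G \<Longrightarrow> \<chi> g = mat_trace (\<rho> g)"
    "\<And>g. g \<notin> carrier G \<Longrightarrow> \<chi> g = 0"
    using IrrE[OF assms(1)] by metis
  note rep = irreducible_repD(1)[OF \<rho>]
  show ?thesis
  proof (cases "\<chi> = \<psi>")
    case True
    have "(\<Sum>g\<in>carrier G. \<chi> g * \<psi> (inv g)) = (\<Sum>g\<in>carrier G. mat_trace (\<rho> g) * mat_trace (\<rho> (inv g)))"
      using True \<chi> by (intro sum.cong) auto
    \<comment> \<open>Matrix units off the diagonal have trace 0, so only the \<open>n\<close> terms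
      with \<open>i = j\<close> remain, each equal to the group order divided by
      \<open>n\<close>.\<close>
    also have "\<dots> = (\<Sum>i<n. \<Sum>j<n. if j = i then of_nat (card (carrier G)) / of_nat n else 0)"
      unfolding sum_trace_products[OF rep rep]
      by (intro sum.cong refl) (auto simp: averaged_scalar[OF \<rho>] mat_trace_mat_unit)
    also have "\<dots> = of_nat (card (carrier G))"
      using irreducible_repD(2)[OF \<rho>] by simp
    finally show ?thesis using True by simp
  next
    case False
    obtain m \<sigma> where \<sigma>: "irreducible_rep G m \<sigma>" and \<psi>: "\<And>g. g \<in> carrier G \<Longrightarrow> \<psi> g = mat_trace (\<sigma> g)"
      "\<And>g. g \<notin> carrier G \<Longrightarrow> \<psi> g = 0"
      using IrrE[OF assms(2)] by metis
    note rep' = irreducible_repD(1)[OF \<sigma>]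
    have zero: "mat_sum n m (\<lambda>g. \<rho> g * X * \<sigma> (inv g)) (carrier G) = 0\<^sub>m n m" (is "?S = _")
      if X: "X \<in> carrier_mat n m" for X
    proof (rule ccontr)
      assume "?S \<noteq> 0\<^sub>m n m"
      note comm = averaged_intertwiner[OF rep rep' X]
      obtain Y where Y: "Y \<in> carrier_mat m n" "?S * Y = 1\<^sub>m n" "Y * ?S = 1\<^sub>m m"
        by (rule schur[OF \<rho> \<sigma> mat_sum_carrier comm \<open>?S \<noteq> 0\<^sub>m n m\<close>])
      \<comment> \<open>Characters are compared as functions on the whole type; outside the carrier
        both are 0 by convention.\<close>
      have "\<chi> g = \<psi> g" for g
      proof (cases "g \<in> carrier G")
        case True
        note rg = is_repD(1)[OF rep True] and sg = is_repD(1)[OF rep' True]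
        have "mat_trace (\<sigma> g) = mat_trace (?S * \<sigma> g * Y)"
          by (rule mat_trace_conj[symmetric, OF _ Y(1) sg Y(3)]) simp
        also have "?S * \<sigma> g * Y = \<rho> g * (?S * Y)"
          unfolding comm[OF True, symmetric] by (rule assoc_mult_mat[OF rg mat_sum_carrier Y(1)])
        also have "\<dots> = \<rho> g" unfolding Y(2) using rg by simp
        finally show ?thesis using \<chi> \<psi> True by simp
      qed (use \<chi> \<psi> in auto)
      with False show False by auto
    qed
    have "(\<Sum>g\<in>carrier G. \<chi> g * \<psi> (inv g)) = (\<Sum>g\<in>carrier G. mat_trace (\<rho> g) * mat_trace (\<sigma> (inv g)))"
      using \<chi> \<psi> by (intro sum.cong) auto
    also have "\<dots> = 0"
      unfolding sum_trace_products[OF rep rep'] by (intro sum.neutral ballI) (simp add: zero)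
    finally show ?thesis using False by simp
  qed
qed

text \<open>By \<open>averaged_scalar\<close> the sum of the conjugates of \<open>\<rho> g\<close>
  is a scalar matrix. Multiplying by \<open>\<rho> k\<close> and taking traces gives the formula,
  and \<open>\<chi> \<one>\<close>, the degree, clears the denominator.\<close>

lemma sum_character_conjugates:
  assumes "\<chi> \<in> Irr G" "g \<in> carrier G" "k \<in> carrier G"
  shows "\<chi> \<one> * (\<Sum>h\<in>carrier G. \<chi> (h \<otimes> g \<otimes> inv h \<otimes> k)) = of_nat (card (carrier G)) * \<chi> g * \<chi> k"
proof -
  obtain n \<rho> where \<rho>: "irreducible_rep G n \<rho>" and \<chi>: "\<And>g. g \<in> carrier G \<Longrightarrow> \<chi> g = mat_trace (\<rho> g)"
    using IrrE[OF assms(1)] by metis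
  note rep = irreducible_repD(1)[OF \<rho>]
  note rg = is_repD(1)[OF rep assms(2)] and rk = is_repD(1)[OF rep assms(3)]
  let ?S = "mat_sum n n (\<lambda>h. \<rho> h * \<rho> g * \<rho> (inv h)) (carrier G)"
  have car: "\<rho> h * \<rho> g * \<rho> (inv h) \<in> carrier_mat n n" if "h \<in> carrier G" for h
    using conj_mat_carrier[OF rep rep rg that] that by simp
  have "(\<Sum>h\<in>carrier G. \<chi> (h \<otimes> g \<otimes> inv h \<otimes> k)) = (\<Sum>h\<in>carrier G. mat_trace (\<rho> h * \<rho> g * \<rho> (inv h) * \<rho> k))"
    using assms(2,3) by (intro sum.cong refl) (simp add: \<chi> is_repD(3)[OF rep])
  also have "\<dots> = mat_trace (mat_sum n n (\<lambda>h. \<rho> h * \<rho> g * \<rho> (inv h) * \<rho> k) (carrier G))"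
    by (rule mat_trace_mat_sum[symmetric]) (rule mult_carrier_mat[OF car rk])
  also have "mat_sum n n (\<lambda>h. \<rho> h * \<rho> g * \<rho> (inv h) * \<rho> k) (carrier G) = ?S * \<rho> k"
    by (rule mat_sum_mult[OF rk, symmetric]) (rule car)
  also have "?S * \<rho> k = (of_nat (card (carrier G)) * \<chi> g / of_nat n) \<cdot>\<^sub>m \<rho> k"
    unfolding averaged_scalar[OF \<rho> rg] \<chi>[OF assms(2)] mult_smult_assoc_mat[OF one_carrier_mat rk]
    using rk by simp
  also have "mat_trace \<dots> = of_nat (card (carrier G)) * \<chi> g / of_nat n * \<chi> k"
    using mat_trace_smult[OF rk] \<chi>[OF assms(3)] by simp
  finally have "of_nat n * (\<Sum>h\<in>carrier G. \<chi> (h \<otimes> g \<otimes> inv h \<otimes> k)) = of_nat (card (carrier G)) * \<chi> g * \<chi> k"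
    using irreducible_repD(2)[OF \<rho>] by simp
  moreover have "\<chi> \<one> = of_nat n" using \<chi>[of \<one>] is_repD(2)[OF rep] by (simp add: mat_trace_one)
  ultimately show ?thesis by simp
qed

section \<open>Degrees, values at inverses, and twisted conjugates of irreducible characters\<close>

lemma Irr_one:
  assumes "\<chi> \<in> Irr G"
  obtains n where "n > 0" "\<chi> \<one> = of_nat n"
  using IrrE[OF assms] is_repD(2)[OF irreducible_repD(1)] irreducible_repD(2) mat_trace_one one_closed
  by metis

text \<open>The form averaged over the group is nondegenerate, as its kernel is a proper invariant
  subspace; it intertwines \<open>\<rho>\<close> with the conjugate dual.\<close>
lemma Irr_inv:
  assumes "\<chi> \<in> Irr G" "h \<in> carrier G"
  shows "\<chi> (inv h) = cnj (\<chi> h)"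
proof -
  obtain n \<rho> where \<rho>: "irreducible_rep G n \<rho>" and \<chi>: "\<And>g. g \<in> carrier G \<Longrightarrow> \<chi> g = mat_trace (\<rho> g)"
    using IrrE[OF assms(1)] by metis
  note rep = irreducible_repD(1)[OF \<rho>] and n = irreducible_repD(2)[OF \<rho>]
  note r = is_repD(1)[OF rep]
  \<comment> \<open>\<open>ad g\<close> is the conjugate transpose of \<open>\<rho> g\<close> and
    reverses products, hence \<open>ad (inv g)\<close> is the conjugate dual.\<close>
  define ad where "ad g = map_mat cnj (transpose_mat (\<rho> g))" for g
  have ad: "ad g \<in> carrier_mat n n" if "g \<in> carrier G" for g
    using r[OF that] by (simp add: ad_def)
  have ad_mult: "ad (g \<otimes> k) = ad k * ad g" if "g \<in> carrier G" "k \<in> carrier G" for g k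
    unfolding ad_def is_repD(3)[OF rep that] transpose_mult[OF r[OF that(1)] r[OF that(2)]]
    using r that by (intro map_mat_cnj_mult[of _ n n _ n]) auto
  \<comment> \<open>Gram matrix of the standard Hermitian form summed over all its translates by the
    group.\<close>
  define H where "H = mat_sum n n (\<lambda>g. ad g * \<rho> g) (carrier G)"
  have Hc: "H \<in> carrier_mat n n" by (simp add: H_def)
  have H: "H * \<rho> h = ad (inv h) * H" if h: "h \<in> carrier G" for h
  proof -
    have "H * \<rho> h = mat_sum n n (\<lambda>g. ad g * \<rho> g * \<rho> h) (carrier G)"
      unfolding H_def by (rule mat_sum_mult[OF r[OF h]]) (rule mult_carrier_mat[OF ad r])
    also have "\<dots> = mat_sum n n (\<lambda>g. ad (inv h) * (ad (g \<otimes> h) * \<rho> (g \<otimes> h))) (carrier G)"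
    proof (rule mat_sum_cong)
      fix g assume g: "g \<in> carrier G"
      have "ad (inv h) * ad (g \<otimes> h) = ad g"
        using g h by (simp add: ad_mult[symmetric] m_assoc)
      then have "ad (inv h) * (ad (g \<otimes> h) * \<rho> (g \<otimes> h)) = ad g * \<rho> (g \<otimes> h)"
        using assoc_mult_mat[OF ad[of "inv h"] ad[of "g \<otimes> h"] r[of "g \<otimes> h"]] g h by simp
      also have "\<dots> = ad g * \<rho> g * \<rho> h"
        using assoc_mult_mat[OF ad[OF g] r[OF g] r[OF h]] is_repD(3)[OF rep g h] by simp
      finally show "ad g * \<rho> g * \<rho> h = ad (inv h) * (ad (g \<otimes> h) * \<rho> (g \<otimes> h))" by simp
    qed
    also have "\<dots> = mat_sum n n (\<lambda>g. ad (inv h) * (ad g * \<rho> g)) (carrier G)"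
      by (rule mat_sum_reindex[OF bij_mult_right[OF h], symmetric])
    also have "\<dots> = ad (inv h) * H"
      unfolding H_def using h by (intro mult_mat_sum[symmetric] ad mult_carrier_mat[OF ad r]) auto
    finally show ?thesis .
  qed
  \<comment> \<open>One positive entry suffices: it shows that \<open>H\<close> is nonzero, and
    irreducibility then gives invertibility. The entry is a sum of squared norms of first columns,
    to which the identity element contributes 1.\<close>
  have "H $$ (0, 0) = complex_of_real (\<Sum>g\<in>carrier G. \<Sum>l<n. (cmod (\<rho> g $$ (l, 0)))\<^sup>2)"
  proof -
    have "(ad g * \<rho> g) $$ (0, 0) = complex_of_real (\<Sum>l<n. (cmod (\<rho> g $$ (l, 0)))\<^sup>2)" if "g \<in> carrier G" for g
      unfolding mult_mat_index[OF ad[OF that] r[OF that] n n] using r[OF that] n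
      by (auto simp: ad_def complex_norm_square mult.commute simp del: of_real_power intro!: sum.cong)
    then show ?thesis using n by (simp add: H_def)
  qed
  moreover have "(\<Sum>g\<in>carrier G. \<Sum>l<n. (cmod (\<rho> g $$ (l, 0)))\<^sup>2) > 0"
  proof (rule sum_pos2[of _ \<one>])
    show "(\<Sum>l<n. (cmod (\<rho> \<one> $$ (l, 0)))\<^sup>2) > 0"
      by (rule sum_pos2[of _ 0]) (use n is_repD(2)[OF rep] in auto)
  qed (auto intro: sum_nonneg)
  ultimately have "H $$ (0, 0) \<noteq> 0" by (simp only: of_real_eq_0_iff)
  then have nz: "H \<noteq> 0\<^sub>m n n" using n by auto
  have "v = 0\<^sub>v n" if v: "v \<in> carrier_vec n" "H *\<^sub>v v = 0\<^sub>v n" for v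
  proof (rule kernel_invariant_trivial[OF \<rho> Hc _ nz v])
    fix g v assume g: "g \<in> carrier G" and v: "v \<in> carrier_vec n" "H *\<^sub>v v = 0\<^sub>v n"
    have "H *\<^sub>v (\<rho> g *\<^sub>v v) = (H * \<rho> g) *\<^sub>v v"
      by (rule assoc_mult_mat_vec[symmetric, OF Hc r[OF g] v(1)])
    also have "\<dots> = ad (inv g) *\<^sub>v (H *\<^sub>v v)"
      unfolding H[OF g] using g by (intro assoc_mult_mat_vec[OF ad Hc v(1)]) simp
    also have "\<dots> = 0\<^sub>v n" unfolding v(2) using ad[of "inv g"] g by auto
    finally show "H *\<^sub>v (\<rho> g *\<^sub>v v) = 0\<^sub>v n" .
  qed
  then obtain K where K: "K \<in> carrier_mat n n" "H * K = 1\<^sub>m n" "K * H = 1\<^sub>m n"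
    by (rule trivial_kernel_imp_inverse[OF Hc])
  have "mat_trace (\<rho> h) = mat_trace (H * \<rho> h * K)"
    by (rule mat_trace_conj[symmetric, OF Hc K(1) r[OF assms(2)] K(3)])
  also have "H * \<rho> h * K = ad (inv h) * (H * K)"
    unfolding H[OF assms(2)] using assms(2) by (intro assoc_mult_mat[OF ad Hc K(1)]) simp
  also have "\<dots> = ad (inv h)" unfolding K(2) using ad[of "inv h"] assms(2) by simp
  also have "mat_trace (ad (inv h)) = cnj (mat_trace (\<rho> (inv h)))"
    using r[of "inv h"] assms(2) by (simp add: mat_trace_def ad_def)
  finally show ?thesis using \<chi> assms(2) by simp
qed

text \<open>The function is the trace of the entrywise conjugate of \<open>\<rho>\<close> scaled by
  \<open>\<xi>\<close>. A subspace invariant under it becomes invariant under \<open>\<rho>\<close>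
  after conjugating its vectors, since the nonzero scalars \<open>\<xi> g\<close> can be divided
  out. The value 0 off the carrier matches \<open>character\<close>.\<close>

lemma twisted_conjugate_Irr:
  assumes "\<chi> \<in> Irr G" and \<xi>: "linear_character G \<xi>"
  shows "(\<lambda>g. if g \<in> carrier G then cnj (\<chi> g) * \<xi> g else 0) \<in> Irr G"
proof -
  obtain n \<rho> where \<rho>: "irreducible_rep G n \<rho>" and \<chi>: "\<And>g. g \<in> carrier G \<Longrightarrow> \<chi> g = mat_trace (\<rho> g)"
    using IrrE[OF assms(1)] by metis
  note rep = irreducible_repD(1)[OF \<rho>] and n = irreducible_repD(2)[OF \<rho>]
  note r = is_repD(1)[OF rep]
  have \<xi>_nz: "\<xi> g \<noteq> 0" if "g \<in> carrier G" for g using \<xi> that by (simp add: linear_character_def)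
  have \<xi>_mult: "\<xi> (g \<otimes> h) = \<xi> g * \<xi> h" if "g \<in> carrier G" "h \<in> carrier G" for g h
    using \<xi> that by (simp add: linear_character_def)
  have "\<xi> \<one> * \<xi> \<one> = \<xi> \<one>" using \<xi>_mult[of \<one> \<one>] by simp
  then have \<xi>_one: "\<xi> \<one> = 1" using \<xi>_nz[of \<one>] by simp
  define \<sigma> where "\<sigma> g = \<xi> g \<cdot>\<^sub>m map_mat cnj (\<rho> g)" for g
  have cr: "map_mat cnj (\<rho> g) \<in> carrier_mat n n" if "g \<in> carrier G" for g using r[OF that] by simp
  have rep': "is_rep G n \<sigma>" unfolding is_rep_def
  proof (intro conjI ballI)
    show "\<sigma> \<one> = 1\<^sub>m n" unfolding \<sigma>_def is_repD(2)[OF rep] \<xi>_one by (rule eq_matI) auto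
    fix g h assume g: "g \<in> carrier G" and h: "h \<in> carrier G"
    show "\<sigma> (g \<otimes> h) = \<sigma> g * \<sigma> h"
      unfolding \<sigma>_def is_repD(3)[OF rep g h] map_mat_cnj_mult[OF r[OF g] r[OF h]]
        mult_smult_assoc_mat[OF cr[OF g] smult_carrier_mat[OF cr[OF h]]]
        mult_smult_distrib[OF cr[OF g] cr[OF h]] \<xi>_mult[OF g h]
      by (rule eq_matI) auto
  qed (use cr in \<open>auto simp: \<sigma>_def\<close>)
  have "irreducible_rep G n \<sigma>" unfolding irreducible_rep_def
  proof (intro conjI rep' n allI impI)
    fix W assume "is_subspace n W \<and> (\<forall>g\<in>carrier G. \<forall>w\<in>W. \<sigma> g *\<^sub>v w \<in> W)"
    then have W: "is_subspace n W" and inv: "\<And>g w. g \<in> carrier G \<Longrightarrow> w \<in> W \<Longrightarrow> \<sigma> g *\<^sub>v w \<in> W"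
      by auto
    have Wc: "w \<in> carrier_vec n" if "w \<in> W" for w using W that by (auto simp: is_subspace_def)
    \<comment> \<open>Conjugation is semilinear, yet it maps complex subspaces to complex subspaces,
      because \<open>W\<close> is closed under all scalars.\<close>
    let ?W = "{v \<in> carrier_vec n. conjugate v \<in> W}"
    have sub: "is_subspace n ?W"
      using W unfolding is_subspace_def
      by (auto simp: conjugate_add_vec[of _ n] conjugate_smult_vec)
    have "?W = {0\<^sub>v n} \<or> ?W = carrier_vec n"
    proof (rule irreducible_repD(3)[OF \<rho> sub])
      fix g v assume g: "g \<in> carrier G" and "v \<in> ?W"
      then have v: "v \<in> carrier_vec n" "conjugate v \<in> W" by auto
      have cv: "conjugate v \<in> carrier_vec n" using v by simp
      have "\<sigma> g *\<^sub>v conjugate v = \<xi> g \<cdot>\<^sub>v conjugate (\<rho> g *\<^sub>v v)"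
        unfolding map_mat_cnj_mult_vec[OF r[OF g] v(1), symmetric] \<sigma>_def
        using cr[OF g] v(1) by (intro eq_vecI) (auto simp: scalar_prod_def sum_distrib_left mult.assoc intro!: sum.cong)
      then have "inverse (\<xi> g) \<cdot>\<^sub>v (\<xi> g \<cdot>\<^sub>v conjugate (\<rho> g *\<^sub>v v)) \<in> W"
        using inv[OF g v(2)] W by (simp add: is_subspace_def)
      then have "conjugate (\<rho> g *\<^sub>v v) \<in> W"
        using \<xi>_nz[OF g] by (simp add: smult_smult_assoc)
      then show "\<rho> g *\<^sub>v v \<in> ?W" using mult_mat_vec_carrier[OF r[OF g] v(1)] by simp
    qed
    then show "W = {0\<^sub>v n} \<or> W = carrier_vec n"
    proof
      assume W0: "?W = {0\<^sub>v n}"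
      have "w = 0\<^sub>v n" if "w \<in> W" for w
      proof -
        have "conjugate w \<in> ?W" using that Wc[OF that] by simp
        then have "conjugate w = 0\<^sub>v n" unfolding W0 by simp
        then have "conjugate (conjugate w) = 0\<^sub>v n" by simp
        then show ?thesis by simp
      qed
      moreover have "0\<^sub>v n \<in> W" using W by (simp add: is_subspace_def)
      ultimately show ?thesis by blast
    next
      assume W1: "?W = carrier_vec n"
      have "w \<in> W" if "w \<in> carrier_vec n" for w
      proof -
        have "conjugate w \<in> ?W" unfolding W1 using that by simp
        then show ?thesis by simp
      qed
      then show ?thesis using Wc by blast
    qed
  qed
  then show ?thesis
  proof (rule IrrI)
    fix g assume g: "g \<in> carrier G"
    have "mat_trace (map_mat cnj (\<rho> g)) = cnj (mat_trace (\<rho> g))"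
      using r[OF g] by (simp add: mat_trace_def)
    then show "(if g \<in> carrier G then cnj (\<chi> g) * \<xi> g else 0) = mat_trace (\<sigma> g)"
      unfolding \<sigma>_def mat_trace_smult[OF cr[OF g]] using \<chi> g by simp
  qed simp
qed

end

section \<open>The regular representation and column orthogonality\<close>

text \<open>In a basis adapted to \<open>W\<close> all matrices are block upper triangular. The
  diagonal blocks describe the action on \<open>W\<close> and on the quotient by \<open>W\<close>;
  the block above the diagonal does not affect the trace.\<close>

lemma reducible_rep_blocks:
  assumes \<rho>: "is_rep G n \<rho>" and W: "is_subspace n W" "W \<noteq> {0\<^sub>v n}" "W \<noteq> carrier_vec n"
    and inv: "\<And>g w. g \<in> carrier G \<Longrightarrow> w \<in> W \<Longrightarrow> \<rho> g *\<^sub>v w \<in> W"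
  obtains r \<alpha> \<delta> where "r < n" "n - r < n" "is_rep G r \<alpha>" "is_rep G (n - r) \<delta>"
    "\<And>g. g \<in> carrier G \<Longrightarrow> mat_trace (\<rho> g) = mat_trace (\<alpha> g) + mat_trace (\<delta> g)"
proof -
  obtain r P Q where r: "0 < r" "r < n" and P: "P \<in> carrier_mat n n" and Q: "Q \<in> carrier_mat n n"
    and PQ: "P * Q = 1\<^sub>m n" and QP: "Q * P = 1\<^sub>m n"
    and cols: "\<And>i. i < r \<Longrightarrow> col P i \<in> W"
    and coords: "\<And>w i. w \<in> W \<Longrightarrow> r \<le> i \<Longrightarrow> i < n \<Longrightarrow> (Q *\<^sub>v w) $ i = 0"
    using adapted_basis[OF W] by metis
  note c = is_repD(1)[OF \<rho>]
  define \<beta> where "\<beta> g = Q * (\<rho> g * P)" for g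
  have \<rho>P: "\<rho> g * P \<in> carrier_mat n n" if "g \<in> carrier G" for g
    by (rule mult_carrier_mat[OF c[OF that] P])
  have \<beta>c: "\<beta> g \<in> carrier_mat n n" if "g \<in> carrier G" for g
    unfolding \<beta>_def by (rule mult_carrier_mat[OF Q \<rho>P[OF that]])
  have \<beta>_mult: "\<beta> (g \<otimes>\<^bsub>G\<^esub> h) = \<beta> g * \<beta> h" if g: "g \<in> carrier G" and h: "h \<in> carrier G" for g h
  proof -
    have "\<beta> g * \<beta> h = Q * ((\<rho> g * P) * (Q * (\<rho> h * P)))"
      unfolding \<beta>_def by (rule assoc_mult_mat[OF Q \<rho>P[OF g] mult_carrier_mat[OF Q \<rho>P[OF h]]])
    also have "(\<rho> g * P) * (Q * (\<rho> h * P)) = \<rho> g * (P * (Q * (\<rho> h * P)))"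
      by (rule assoc_mult_mat[OF c[OF g] P mult_carrier_mat[OF Q \<rho>P[OF h]]])
    also have "P * (Q * (\<rho> h * P)) = \<rho> h * P"
      using assoc_mult_mat[OF P Q \<rho>P[OF h]] left_mult_one_mat[OF \<rho>P[OF h]] PQ by simp
    also have "\<rho> g * (\<rho> h * P) = \<rho> (g \<otimes>\<^bsub>G\<^esub> h) * P"
      unfolding is_repD(3)[OF \<rho> g h] by (rule assoc_mult_mat[symmetric, OF c[OF g] c[OF h] P])
    finally show ?thesis by (simp add: \<beta>_def)
  qed
  have \<beta>_one: "\<beta> \<one>\<^bsub>G\<^esub> = 1\<^sub>m n"
    unfolding \<beta>_def is_repD(2)[OF \<rho>] using P QP by simp
  \<comment> \<open>The lower left block vanishes: \<open>\<rho> g\<close> maps a basis vector of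
    \<open>W\<close> into \<open>W\<close>, where coordinates from \<open>r\<close> on are
    0.\<close>
  have \<beta>_zero: "\<beta> g $$ (i, j) = 0" if g: "g \<in> carrier G" and "r \<le> i" "i < n" "j < r" for g i j
  proof -
    have "col (\<rho> g * P) j = \<rho> g *\<^sub>v col P j" using that r by (intro col_mult2[OF c[OF g] P]) simp
    then have "col (\<rho> g * P) j \<in> W" using inv[OF g cols] that by simp
    then have "(Q *\<^sub>v col (\<rho> g * P) j) $ i = 0" using coords that by simp
    also have "(Q *\<^sub>v col (\<rho> g * P) j) $ i = \<beta> g $$ (i, j)"
      unfolding \<beta>_def using Q P that r by simp
    finally show ?thesis .
  qed
  define \<alpha> where "\<alpha> g = mat r r (\<lambda>(i, j). \<beta> g $$ (i, j))" for g
  define \<delta> where "\<delta> g = mat (n - r) (n - r) (\<lambda>(i, j). \<beta> g $$ (i + r, j + r))" for g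
  have split: "(\<Sum>l<n. f l) = (\<Sum>l<r. f l) + (\<Sum>l<n - r. f (l + r))" for f :: "nat \<Rightarrow> complex"
  proof -
    have "(\<Sum>l<n. f l) = (\<Sum>l<r. f l) + (\<Sum>l=r..<n. f l)"
      using r sum.atLeastLessThan_concat[of 0 r n f] by (simp add: atLeast0LessThan)
    also have "(\<Sum>l=r..<n. f l) = (\<Sum>l<n - r. f (l + r))"
      using sum.shift_bounds_nat_ivl[of f 0 r "n - r"] r by (simp add: atLeast0LessThan)
    finally show ?thesis .
  qed
  have \<alpha>c: "\<alpha> g \<in> carrier_mat r r" and \<delta>c: "\<delta> g \<in> carrier_mat (n - r) (n - r)" for g
    by (simp_all add: \<alpha>_def \<delta>_def)
  have \<beta>_index: "\<beta> (g \<otimes>\<^bsub>G\<^esub> h) $$ (i, j)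
      = (\<Sum>l<r. \<beta> g $$ (i, l) * \<beta> h $$ (l, j)) + (\<Sum>l<n - r. \<beta> g $$ (i, l + r) * \<beta> h $$ (l + r, j))"
    if g: "g \<in> carrier G" and h: "h \<in> carrier G" and ij: "i < n" "j < n" for g h i j
    unfolding \<beta>_mult[OF g h] mult_mat_index[OF \<beta>c[OF g] \<beta>c[OF h] ij] split ..
  have "is_rep G r \<alpha>" unfolding is_rep_def
  proof (intro conjI ballI)
    show "\<alpha> \<one>\<^bsub>G\<^esub> = 1\<^sub>m r" unfolding \<alpha>_def \<beta>_one using r by (intro eq_matI) auto
    fix g h assume g: "g \<in> carrier G" and h: "h \<in> carrier G"
    show "\<alpha> (g \<otimes>\<^bsub>G\<^esub> h) = \<alpha> g * \<alpha> h"
    proof (rule eq_matI)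
      fix i j assume "i < dim_row (\<alpha> g * \<alpha> h)" "j < dim_col (\<alpha> g * \<alpha> h)"
      then have ij: "i < r" "j < r" by (simp_all add: \<alpha>_def)
      \<comment> \<open>The cross terms of the upper block die through the zero block of the right
        factor; for the lower block it is that of the left factor.\<close>
      have "(\<Sum>l<n - r. \<beta> g $$ (i, l + r) * \<beta> h $$ (l + r, j)) = 0"
        using \<beta>_zero[OF h] ij by (intro sum.neutral) auto
      then show "\<alpha> (g \<otimes>\<^bsub>G\<^esub> h) $$ (i, j) = (\<alpha> g * \<alpha> h) $$ (i, j)"
        unfolding mult_mat_index[OF \<alpha>c \<alpha>c ij] using \<beta>_index[OF g h, of i j] ij r by (simp add: \<alpha>_def)
    qed (auto simp: \<alpha>_def)
  qed (rule \<alpha>c)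
  moreover have "is_rep G (n - r) \<delta>" unfolding is_rep_def
  proof (intro conjI ballI)
    show "\<delta> \<one>\<^bsub>G\<^esub> = 1\<^sub>m (n - r)" unfolding \<delta>_def \<beta>_one using r by (intro eq_matI) auto
    fix g h assume g: "g \<in> carrier G" and h: "h \<in> carrier G"
    show "\<delta> (g \<otimes>\<^bsub>G\<^esub> h) = \<delta> g * \<delta> h"
    proof (rule eq_matI)
      fix i j assume "i < dim_row (\<delta> g * \<delta> h)" "j < dim_col (\<delta> g * \<delta> h)"
      then have ij: "i < n - r" "j < n - r" by (simp_all add: \<delta>_def)
      have "(\<Sum>l<r. \<beta> g $$ (i + r, l) * \<beta> h $$ (l, j + r)) = 0"
        using \<beta>_zero[OF g] ij by (intro sum.neutral) auto
      then show "\<delta> (g \<otimes>\<^bsub>G\<^esub> h) $$ (i, j) = (\<delta> g * \<delta> h) $$ (i, j)"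
        unfolding mult_mat_index[OF \<delta>c \<delta>c ij] using \<beta>_index[OF g h, of "i + r" "j + r"] ij r
        by (simp add: \<delta>_def)
    qed (auto simp: \<delta>_def)
  qed (rule \<delta>c)
  moreover have "mat_trace (\<rho> g) = mat_trace (\<alpha> g) + mat_trace (\<delta> g)" if g: "g \<in> carrier G" for g
  proof -
    have "mat_trace (\<rho> g) = mat_trace (Q * \<rho> g * P)"
      by (rule mat_trace_conj[symmetric, OF Q P c[OF g] PQ])
    also have "Q * \<rho> g * P = \<beta> g"
      unfolding \<beta>_def by (rule assoc_mult_mat[OF Q c[OF g] P])
    also have "mat_trace (\<beta> g) = mat_trace (\<alpha> g) + mat_trace (\<delta> g)"
      unfolding mat_trace_eq[OF \<beta>c[OF g]] mat_trace_eq[OF \<alpha>c] mat_trace_eq[OF \<delta>c] split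
      by (simp add: \<alpha>_def \<delta>_def)
    finally show ?thesis .
  qed
  ultimately show ?thesis using that r by simp
qed

lemma sum_list_eq_sum_count:
  fixes f :: "'a \<Rightarrow> 'b :: comm_semiring_1"
  assumes "finite A" "set xs \<subseteq> A"
  shows "(\<Sum>x\<leftarrow>xs. f x) = (\<Sum>x\<in>A. of_nat (count_list xs x) * f x)"
  using assms(2)
proof (induction xs)
  case (Cons y xs)
  have "(\<Sum>x\<in>A. of_nat (count_list (y # xs) x) * f x)
      = (\<Sum>x\<in>A. (if x = y then f y else 0) + of_nat (count_list xs x) * f x)"
    by (intro sum.cong) (auto simp: algebra_simps)
  then show ?case using Cons assms(1) by (simp add: sum.distrib)
qed simp

context finite_group
begin

text \<open>Induction on the dimension, splitting off the two diagonal blocks. A list records the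
  constituents because they may repeat and because \<open>Irr G\<close> is not yet known to be
  finite.\<close>

lemma rep_trace_sum_Irr:
  assumes "is_rep G n \<rho>"
  shows "\<exists>\<chi>s. set \<chi>s \<subseteq> Irr G \<and> (\<forall>g\<in>carrier G. mat_trace (\<rho> g) = (\<Sum>\<chi>\<leftarrow>\<chi>s. \<chi> g))"
  using assms
proof (induction n arbitrary: \<rho> rule: less_induct)
  case (less n)
  note rep = less.prems
  consider "n = 0" | "irreducible_rep G n \<rho>" | "n > 0" "\<not> irreducible_rep G n \<rho>" by blast
  then show ?case
  proof cases
    \<comment> \<open>\<open>is_rep\<close> admits dimension 0 while \<open>irreducible_rep\<close>
      excludes it; here the empty list serves.\<close>
    case 1
    then have "mat_trace (\<rho> g) = 0" if "g \<in> carrier G" for g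
      using is_repD(1)[OF rep that] by (simp add: mat_trace_def)
    then show ?thesis by (intro exI[of _ "[]"]) simp
  next
    case 2
    then have "character G \<rho> \<in> Irr G" by (auto simp: Irr_def)
    then show ?thesis by (intro exI[of _ "[character G \<rho>]"]) (simp add: character_def)
  next
    case 3
    then obtain W where W: "is_subspace n W" "W \<noteq> {0\<^sub>v n}" "W \<noteq> carrier_vec n"
      and inv: "\<And>g w. g \<in> carrier G \<Longrightarrow> w \<in> W \<Longrightarrow> \<rho> g *\<^sub>v w \<in> W"
      using rep unfolding irreducible_rep_def by blast
    obtain r \<alpha> \<delta> where r: "r < n" "n - r < n" "is_rep G r \<alpha>" "is_rep G (n - r) \<delta>"
      and tr: "\<And>g. g \<in> carrier G \<Longrightarrow> mat_trace (\<rho> g) = mat_trace (\<alpha> g) + mat_trace (\<delta> g)"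
      using reducible_rep_blocks[OF rep W inv] by metis
    obtain as ds where "set as \<subseteq> Irr G" "\<forall>g\<in>carrier G. mat_trace (\<alpha> g) = (\<Sum>\<chi>\<leftarrow>as. \<chi> g)"
      "set ds \<subseteq> Irr G" "\<forall>g\<in>carrier G. mat_trace (\<delta> g) = (\<Sum>\<chi>\<leftarrow>ds. \<chi> g)"
      using less.IH[OF r(1,3)] less.IH[OF r(2,4)] by blast
    then show ?thesis using tr by (intro exI[of _ "as @ ds"]) simp
  qed
qed

text \<open>Permutation matrices of left multiplication, with an enumeration \<open>e\<close> of the
  group supplying the indices. The trace counts fixed points, and only \<open>\<one>\<close> fixes
  an element under left multiplication.\<close>

lemma regular_rep:
  obtains n \<rho> where "is_rep G n \<rho>"
    "\<And>g. g \<in> carrier G \<Longrightarrow> mat_trace (\<rho> g) = (if g = \<one> then of_nat (card (carrier G)) else 0)"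
proof -
  define n where "n = card (carrier G)"
  obtain e where e: "bij_betw e {..<n} (carrier G)"
    using ex_bij_betw_nat_finite[OF finite_carrier] by (auto simp: n_def atLeast0LessThan)
  have e_car: "e i \<in> carrier G" if "i < n" for i using e that by (auto simp: bij_betw_def)
  have e_inj: "e i = e j \<longleftrightarrow> i = j" if "i < n" "j < n" for i j
    using e that by (auto simp: bij_betw_def inj_on_def)
  define \<rho> where "\<rho> g = (mat n n (\<lambda>(i, j). if e i = g \<otimes> e j then 1 else 0) :: complex mat)" for g
  have \<rho>c: "\<rho> g \<in> carrier_mat n n" for g by (simp add: \<rho>_def)
  have "is_rep G n \<rho>" unfolding is_rep_def
  proof (intro conjI ballI)
    show "\<rho> \<one> = 1\<^sub>m n" by (rule eq_matI) (auto simp: \<rho>_def e_car e_inj)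
    fix g h assume g: "g \<in> carrier G" and h: "h \<in> carrier G"
    show "\<rho> (g \<otimes> h) = \<rho> g * \<rho> h"
    proof (rule eq_matI)
      fix i j assume "i < dim_row (\<rho> g * \<rho> h)" "j < dim_col (\<rho> g * \<rho> h)"
      then have ij: "i < n" "j < n" by (simp_all add: \<rho>_def)
      have "h \<otimes> e j \<in> carrier G" using h e_car ij by simp
      then obtain k where k: "k < n" "e k = h \<otimes> e j"
        using e unfolding bij_betw_def by (metis imageE lessThan_iff)
      have "(\<rho> g * \<rho> h) $$ (i, j) = (\<Sum>l<n. if l = k then if e i = g \<otimes> e l then 1 else 0 else 0)"
        unfolding mult_mat_index[OF \<rho>c \<rho>c ij]
        using ij k(1) e_inj by (intro sum.cong) (auto simp: \<rho>_def k(2)[symmetric])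
      also have "\<dots> = (if e i = g \<otimes> (h \<otimes> e j) then 1 else 0)" using k by simp
      also have "\<dots> = \<rho> (g \<otimes> h) $$ (i, j)"
        using g h ij e_car by (simp add: \<rho>_def m_assoc)
      finally show "\<rho> (g \<otimes> h) $$ (i, j) = (\<rho> g * \<rho> h) $$ (i, j)" by simp
    qed (auto simp: \<rho>_def)
  qed (rule \<rho>c)
  moreover have "mat_trace (\<rho> g) = (if g = \<one> then of_nat (card (carrier G)) else 0)" if g: "g \<in> carrier G" for g
  proof -
    have "e i = g \<otimes> e i \<longleftrightarrow> g = \<one>" if "i < n" for i
      using g e_car[OF that] by simp
    then have "mat_trace (\<rho> g) = (\<Sum>i<n. if g = \<one> then 1 else 0)"
      unfolding mat_trace_eq[OF \<rho>c] by (intro sum.cong) (auto simp: \<rho>_def)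
    then show ?thesis by (simp add: n_def)
  qed
  ultimately show ?thesis by (rule that)
qed

text \<open>Pairing the regular character with \<open>\<psi>\<close> in two ways shows that
  \<open>\<psi>\<close> has multiplicity \<open>\<psi> \<one>\<close> in it. This is nonzero, so the
  finite list of constituents exhausts \<open>Irr G\<close>. The decomposition itself is then the
  degree formula.\<close>

lemma finite_Irr: "finite (Irr G)"
  and sum_Irr_degree:
    "g \<in> carrier G \<Longrightarrow> (\<Sum>\<chi>\<in>Irr G. \<chi> \<one> * \<chi> g) = (if g = \<one> then of_nat (card (carrier G)) else 0)"
proof -
  let ?N = "of_nat (card (carrier G)) :: complex"
  obtain n \<rho> where rep: "is_rep G n \<rho>"
    and tr: "\<And>g. g \<in> carrier G \<Longrightarrow> mat_trace (\<rho> g) = (if g = \<one> then ?N else 0)"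
    using regular_rep by metis
  obtain \<chi>s where sub: "set \<chi>s \<subseteq> Irr G"
    and "\<forall>g\<in>carrier G. mat_trace (\<rho> g) = (\<Sum>\<chi>\<leftarrow>\<chi>s. \<chi> g)"
    using rep_trace_sum_Irr[OF rep] by blast
  then have reg: "(if g = \<one> then ?N else 0) = (\<Sum>\<chi>\<in>set \<chi>s. of_nat (count_list \<chi>s \<chi>) * \<chi> g)"
    if "g \<in> carrier G" for g
    using tr[OF that] that by (simp add: sum_list_eq_sum_count[of "set \<chi>s"])
  have mult: "of_nat (count_list \<chi>s \<psi>) = \<psi> \<one>" if \<psi>: "\<psi> \<in> Irr G" for \<psi>
  proof -
    have "?N * \<psi> \<one> = (\<Sum>g\<in>carrier G. if g = \<one> then ?N * \<psi> \<one> else 0)"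
      by simp
    also have "\<dots> = (\<Sum>g\<in>carrier G. (if g = \<one> then ?N else 0) * \<psi> (inv g))"
      by (intro sum.cong) auto
    also have "\<dots> = (\<Sum>g\<in>carrier G. (\<Sum>\<chi>\<in>set \<chi>s. of_nat (count_list \<chi>s \<chi>) * \<chi> g) * \<psi> (inv g))"
      by (intro sum.cong refl) (simp only: reg)
    also have "\<dots> = (\<Sum>\<chi>\<in>set \<chi>s. of_nat (count_list \<chi>s \<chi>) * (\<Sum>g\<in>carrier G. \<chi> g * \<psi> (inv g)))"
      by (simp add: sum_distrib_left sum_distrib_right mult.assoc) (rule sum.swap)
    also have "\<dots> = (\<Sum>\<chi>\<in>set \<chi>s. if \<chi> = \<psi> then of_nat (count_list \<chi>s \<psi>) * ?N else 0)"
      using sub \<psi> by (intro sum.cong) (auto simp: character_orthogonality)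
    also have "\<dots> = of_nat (count_list \<chi>s \<psi>) * ?N"
      by (simp add: count_list_0_iff)
    finally show ?thesis using card_carrier_pos by (auto simp: card_gt_0_iff)
  qed
  have "\<psi> \<in> set \<chi>s" if "\<psi> \<in> Irr G" for \<psi>
  proof (rule ccontr)
    assume "\<psi> \<notin> set \<chi>s"
    then have "\<psi> \<one> = 0" using mult[OF that] by (simp add: count_list_0_iff)
    then show False using Irr_one[OF that] by (metis of_nat_eq_0_iff less_irrefl)
  qed
  then have eq: "set \<chi>s = Irr G" using sub by blast
  then show "finite (Irr G)" by (metis List.finite_set)
  show "(\<Sum>\<chi>\<in>Irr G. \<chi> \<one> * \<chi> g) = (if g = \<one> then ?N else 0)" if "g \<in> carrier G"
    unfolding reg[OF that] eq by (intro sum.cong) (simp_all add: mult)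
qed

text \<open>In the sum of \<open>sum_character_conjugates\<close> over all \<open>\<chi>\<close>,
  the regular character keeps exactly those \<open>h\<close> with
  \<open>h \<otimes> g \<otimes> inv h \<otimes> k = \<one>\<close>. The right side is the order of
  the centralizer of \<open>g\<close> if \<open>g\<close> is conjugate to \<open>inv k\<close>, and
  0 otherwise; as a count of conjugators it covers both cases at once.\<close>

lemma column_orthogonality:
  assumes g: "g \<in> carrier G" and k: "k \<in> carrier G"
  shows "(\<Sum>\<chi>\<in>Irr G. \<chi> g * \<chi> k) = of_nat (card {h \<in> carrier G. h \<otimes> g \<otimes> inv h = inv k})"
proof -
  let ?N = "of_nat (card (carrier G)) :: complex"
  have "?N * (\<Sum>\<chi>\<in>Irr G. \<chi> g * \<chi> k) = (\<Sum>\<chi>\<in>Irr G. \<chi> \<one> * (\<Sum>h\<in>carrier G. \<chi> (h \<otimes> g \<otimes> inv h \<otimes> k)))"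
    unfolding sum_distrib_left using g k
    by (intro sum.cong refl) (simp add: sum_character_conjugates[unfolded sum_distrib_left] mult.assoc)
  also have "\<dots> = (\<Sum>h\<in>carrier G. \<Sum>\<chi>\<in>Irr G. \<chi> \<one> * \<chi> (h \<otimes> g \<otimes> inv h \<otimes> k))"
    by (simp add: sum_distrib_left) (rule sum.swap)
  also have "\<dots> = (\<Sum>h\<in>carrier G. if h \<otimes> g \<otimes> inv h = inv k then ?N else 0)"
  proof (rule sum.cong[OF refl])
    fix h assume h: "h \<in> carrier G"
    have "h \<otimes> g \<otimes> inv h \<otimes> k = \<one> \<longleftrightarrow> h \<otimes> g \<otimes> inv h = inv k"
      using g h k by (metis inv_closed inv_equality inv_inv l_inv m_closed)
    then show "(\<Sum>\<chi>\<in>Irr G. \<chi> \<one> * \<chi> (h \<otimes> g \<otimes> inv h \<otimes> k)) = (if h \<otimes> g \<otimes> inv h = inv k then ?N else 0)"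
      using g h k by (simp add: sum_Irr_degree)
  qed
  also have "\<dots> = ?N * of_nat (card {h \<in> carrier G. h \<otimes> g \<otimes> inv h = inv k})"
    by (simp add: sum.If_cases Int_def)
  finally show ?thesis using card_carrier_pos by (auto simp: card_gt_0_iff)
qed

end

section \<open>Conjugacy classes\<close>

context finite_group
begin

text \<open>Replacing \<open>x\<close> by its inverse passes to the form of conjugation that occurs
  in the averaged sums.\<close>

lemma conj_class_eq_image:
  assumes "g \<in> carrier G"
  shows "conj_class G g = (\<lambda>h. h \<otimes> g \<otimes> inv h) ` carrier G"
proof -
  have "inv x \<otimes> g \<otimes> x = (\<lambda>h. h \<otimes> g \<otimes> inv h) (inv x)"
    "(\<lambda>h. h \<otimes> g \<otimes> inv h) x = inv (inv x) \<otimes> g \<otimes> inv x" if "x \<in> carrier G" for x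
    using that by auto
  then show ?thesis unfolding conj_class_def by (blast intro: inv_closed)
qed

lemma conj_class_subset: "g \<in> carrier G \<Longrightarrow> conj_class G g \<subseteq> carrier G"
  by (auto simp: conj_class_def)

lemma conj_class_self: "g \<in> carrier G \<Longrightarrow> g \<in> conj_class G g"
  unfolding conj_class_def using one_closed by (force intro: exI[of _ \<one>])

lemma conj_class_eqI:
  assumes g: "g \<in> carrier G" and k: "k \<in> conj_class G g"
  shows "conj_class G k = conj_class G g"
proof -
  obtain a where a: "a \<in> carrier G" "k = a \<otimes> g \<otimes> inv a"
    using k conj_class_eq_image[OF g] by auto
  have kc: "k \<in> carrier G" using a g by simp
  have 1: "h \<otimes> k \<otimes> inv h = (h \<otimes> a) \<otimes> g \<otimes> inv (h \<otimes> a)" if "h \<in> carrier G" for h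
    using that a g by (simp add: inv_mult_group m_assoc)
  have "(\<lambda>h. h \<otimes> k \<otimes> inv h) ` carrier G = (\<lambda>h. h \<otimes> g \<otimes> inv h) ` (\<lambda>h. h \<otimes> a) ` carrier G"
    unfolding image_image by (rule image_cong) (simp_all add: 1)
  then show ?thesis
    using bij_mult_right[OF a(1)] conj_class_eq_image[OF g] conj_class_eq_image[OF kc]
    by (simp add: bij_betw_def)
qed

lemma inv_set_conj_class:
  assumes "g \<in> carrier G"
  shows "inv_set G (conj_class G g) = conj_class G (inv g)"
proof -
  have "inv (h \<otimes> g \<otimes> inv h) = h \<otimes> inv g \<otimes> inv h" if "h \<in> carrier G" for h
    using that assms by (simp add: inv_mult_group m_assoc)
  then show ?thesis using assms
    by (simp add: inv_set_def conj_class_eq_image image_image)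
qed

lemma conj_classesE:
  assumes "C \<in> conj_classes G"
  obtains g where "g \<in> carrier G" "C = conj_class G g"
  using assms by (auto simp: conj_classes_def)

lemma conj_classes_eq:
  assumes "C \<in> conj_classes G" "D \<in> conj_classes G" "x \<in> C" "x \<in> D"
  shows "C = D"
  using assms conj_class_eqI by (metis conj_classesE)

lemma conj_classes_nonempty: "C \<in> conj_classes G \<Longrightarrow> C \<noteq> {}"
  using conj_class_self by (auto simp: conj_classes_def)

lemma inv_set_conj_classes: "C \<in> conj_classes G \<Longrightarrow> inv_set G C \<in> conj_classes G"
  by (auto simp: conj_classes_def inv_set_conj_class)

lemma inv_set_involution: "C \<in> conj_classes G \<Longrightarrow> inv_set G (inv_set G C) = C"
  by (auto simp: conj_classes_def inv_set_conj_class)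

lemma finite_conj_classes [simp]: "finite (conj_classes G)"
  by (simp add: conj_classes_def)

text \<open>Orbit and stabilizer: the elements conjugating \<open>g\<close> to \<open>k\<close> form
  a left coset of the centralizer of \<open>g\<close>, so all fibres of
  \<open>h \<mapsto> h \<otimes> g \<otimes> inv h\<close> over the class have the same
  size.\<close>

lemma card_conjugators:
  assumes g: "g \<in> carrier G" and k: "k \<in> conj_class G g"
  shows "card {h \<in> carrier G. h \<otimes> g \<otimes> inv h = k} * card (conj_class G g) = card (carrier G)"
proof -
  have stab: "card {h \<in> carrier G. h \<otimes> g \<otimes> inv h = k} = card {h \<in> carrier G. h \<otimes> g \<otimes> inv h = g}"
    if k: "k \<in> conj_class G g" for k
  proof -
    obtain a where a: "a \<in> carrier G" "k = a \<otimes> g \<otimes> inv a"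
      using k unfolding conj_class_eq_image[OF g] by auto
    have "bij_betw (\<lambda>h. a \<otimes> h) {h \<in> carrier G. h \<otimes> g \<otimes> inv h = g} {h \<in> carrier G. h \<otimes> g \<otimes> inv h = k}"
    proof (rule bij_betwI[where g = "\<lambda>h. inv a \<otimes> h"])
      show "(\<lambda>h. a \<otimes> h) \<in> {h \<in> carrier G. h \<otimes> g \<otimes> inv h = g} \<rightarrow> {h \<in> carrier G. h \<otimes> g \<otimes> inv h = k}"
      proof
        fix h assume "h \<in> {h \<in> carrier G. h \<otimes> g \<otimes> inv h = g}"
        then have h: "h \<in> carrier G" "h \<otimes> g \<otimes> inv h = g" by auto
        have "(a \<otimes> h) \<otimes> g \<otimes> inv (a \<otimes> h) = a \<otimes> (h \<otimes> g \<otimes> inv h) \<otimes> inv a"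
          using a g h(1) by (simp add: inv_mult_group m_assoc)
        then show "a \<otimes> h \<in> {h \<in> carrier G. h \<otimes> g \<otimes> inv h = k}" using a h by simp
      qed
      show "(\<lambda>h. inv a \<otimes> h) \<in> {h \<in> carrier G. h \<otimes> g \<otimes> inv h = k} \<rightarrow> {h \<in> carrier G. h \<otimes> g \<otimes> inv h = g}"
      proof
        fix h assume "h \<in> {h \<in> carrier G. h \<otimes> g \<otimes> inv h = k}"
        then have h: "h \<in> carrier G" "h \<otimes> g \<otimes> inv h = k" by auto
        have "(inv a \<otimes> h) \<otimes> g \<otimes> inv (inv a \<otimes> h) = inv a \<otimes> (h \<otimes> g \<otimes> inv h) \<otimes> a"
          using a g h(1) by (simp add: inv_mult_group m_assoc)
        also have "\<dots> = g"
          unfolding h(2) a(2) using a(1) g by (simp add: m_assoc inv_solve_left')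
        finally show "inv a \<otimes> h \<in> {h \<in> carrier G. h \<otimes> g \<otimes> inv h = g}" using a h by simp
      qed
      show "inv a \<otimes> (a \<otimes> h) = h" if "h \<in> {h \<in> carrier G. h \<otimes> g \<otimes> inv h = g}" for h
        using that a(1) by (simp add: m_assoc[symmetric])
      show "a \<otimes> (inv a \<otimes> h) = h" if "h \<in> {h \<in> carrier G. h \<otimes> g \<otimes> inv h = k}" for h
        using that a(1) by (simp add: m_assoc[symmetric])
    qed
    then show ?thesis by (rule bij_betw_same_card[symmetric])
  qed
  have "card (carrier G) = (\<Sum>y\<in>conj_class G g. card {h \<in> carrier G. h \<otimes> g \<otimes> inv h = y})"
    using sum.image_gen[OF finite_carrier, of "\<lambda>_. 1 :: nat" "\<lambda>h. h \<otimes> g \<otimes> inv h"]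
    unfolding conj_class_eq_image[OF g] by (simp only: card_eq_sum)
  also have "\<dots> = card (conj_class G g) * card {h \<in> carrier G. h \<otimes> g \<otimes> inv h = g}"
    by (simp add: stab)
  finally show ?thesis using stab[OF k] by (simp add: mult.commute)
qed

text \<open>Each element \<open>g\<close> of a class \<open>C\<close> in \<open>A\<close> has
  \<open>|G| / |C|\<close> conjugators to \<open>\<phi> g\<close>, so the \<open>|C|\<close>
  elements together contribute \<open>|G|\<close> times \<open>F C\<close>; for other classes there
  are none. With \<open>\<phi> g = g\<close> all classes count, with \<open>\<phi> g = inv g\<close>
  exactly the real ones.\<close>

lemma sum_card_conjugators:
  fixes F :: "'a set \<Rightarrow> complex"
  assumes A: "A \<subseteq> conj_classes G" and \<phi>: "\<And>g. g \<in> carrier G \<Longrightarrow> \<phi> g \<in> conj_class G g \<longleftrightarrow> conj_class G g \<in> A"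
    and f: "\<And>g. g \<in> carrier G \<Longrightarrow> conj_class G g \<in> A \<Longrightarrow> f g = F (conj_class G g)"
  shows "(\<Sum>g\<in>carrier G. of_nat (card {h \<in> carrier G. h \<otimes> g \<otimes> inv h = \<phi> g}) * f g)
       = of_nat (card (carrier G)) * (\<Sum>C\<in>A. F C)" (is "sum ?t _ = ?N * _")
proof -
  have fibre: "{g \<in> carrier G. conj_class G g = C} = C" if C: "C \<in> conj_classes G" for C
  proof -
    obtain a where a: "a \<in> carrier G" "C = conj_class G a" using C by (rule conj_classesE)
    show ?thesis
    proof (intro equalityI subsetI)
      fix g assume "g \<in> {g \<in> carrier G. conj_class G g = C}"
      then show "g \<in> C" using conj_class_self by blast
    next
      fix g assume "g \<in> C"
      then show "g \<in> {g \<in> carrier G. conj_class G g = C}"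
        using conj_class_eqI[OF a(1)] conj_class_subset[OF a(1)] a(2) by blast
    qed
  qed
  have "sum ?t (carrier G) = (\<Sum>C\<in>conj_classes G. sum ?t C)"
    using sum.image_gen[of "carrier G" ?t "conj_class G"] fibre by (simp add: conj_classes_def)
  also have "\<dots> = (\<Sum>C\<in>conj_classes G. if C \<in> A then ?N * F C else 0)"
  proof (rule sum.cong[OF refl])
    fix C assume C: "C \<in> conj_classes G"
    have mem: "g \<in> carrier G \<and> conj_class G g = C" if "g \<in> C" for g using fibre[OF C] that by blast
    show "sum ?t C = (if C \<in> A then ?N * F C else 0)"
    proof (cases "C \<in> A")
      case True
      have finC: "finite C" using mem by (meson finite_carrier finite_subset subsetI)
      have "card C > 0" using conj_classes_nonempty[OF C] finC by (simp add: card_gt_0_iff)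
      have "?t g = ?N * F C / of_nat (card C)" if "g \<in> C" for g
      proof -
        have g: "g \<in> carrier G" "conj_class G g = C" using mem[OF that] by auto
        have "card {h \<in> carrier G. h \<otimes> g \<otimes> inv h = \<phi> g} * card C = card (carrier G)"
          using card_conjugators[of g "\<phi> g"] \<phi>[OF g(1)] g True by simp
        then have "of_nat (card {h \<in> carrier G. h \<otimes> g \<otimes> inv h = \<phi> g}) * of_nat (card C) = ?N"
          by (metis of_nat_mult)
        then show ?thesis using \<open>card C > 0\<close> f[of g] g True by (simp add: field_simps)
      qed
      then show ?thesis using \<open>card C > 0\<close> True by simp
    next
      case False
      have "?t g = 0" if "g \<in> C" for g
      proof -
        have g: "g \<in> carrier G" "\<phi> g \<notin> conj_class G g" using mem[OF that] \<phi> False by auto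
        have "h \<otimes> g \<otimes> inv h \<noteq> \<phi> g" if "h \<in> carrier G" for h
          using g(2) imageI[OF that, of "\<lambda>h. h \<otimes> g \<otimes> inv h"]
          unfolding conj_class_eq_image[OF g(1)] by auto
        then have "{h \<in> carrier G. h \<otimes> g \<otimes> inv h = \<phi> g} = {}" by blast
        then show ?thesis by simp
      qed
      then show ?thesis using False by simp
    qed
  qed
  also have "\<dots> = (\<Sum>C\<in>A. ?N * F C)"
    using A by (simp add: sum.If_cases Int_absorb1)
  finally show ?thesis by (simp add: sum_distrib_left)
qed

text \<open>Sum \<open>\<chi> g * \<chi> (inv g)\<close> over all \<open>\<chi>\<close> and
  \<open>g\<close>. Row orthogonality gives the group order for each character, column orthogonality
  gives it for each class.\<close>

lemma card_Irr: "card (Irr G) = card (conj_classes G)"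
proof -
  let ?N = "of_nat (card (carrier G)) :: complex"
  have "?N * of_nat (card (Irr G)) = (\<Sum>\<chi>\<in>Irr G. \<Sum>g\<in>carrier G. \<chi> g * \<chi> (inv g))"
    by (simp add: character_orthogonality)
  also have "\<dots> = (\<Sum>g\<in>carrier G. of_nat (card {h \<in> carrier G. h \<otimes> g \<otimes> inv h = g}) * 1)"
    by (subst sum.swap) (simp add: column_orthogonality)
  also have "\<dots> = ?N * (\<Sum>C\<in>conj_classes G. 1)"
    by (rule sum_card_conjugators) (auto simp: conj_classes_def conj_class_self)
  finally have "(of_nat (card (Irr G)) :: complex) = of_nat (card (conj_classes G))"
    using card_carrier_pos by (auto simp: card_gt_0_iff)
  then show ?thesis by (simp only: of_nat_eq_iff)
qed

text \<open>\<open>\<xi>\<close> is constant on classes. If \<open>g\<close> is conjugate to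
  \<open>inv g\<close>, then \<open>\<xi> g\<close> equals its own inverse and is therefore 1 or
  -1.\<close>

lemma linear_character_real_class:
  assumes \<xi>: "linear_character G \<xi>" and g: "g \<in> carrier G" and real: "conj_class G g = inv_set G (conj_class G g)"
  shows "\<xi> (inv g) = (if \<forall>c\<in>conj_class G g. \<xi> c = -1 then -1 else 1)"
proof -
  have nz: "\<xi> g \<noteq> 0" if "g \<in> carrier G" for g using \<xi> that by (simp add: linear_character_def)
  have mult: "\<xi> (g \<otimes> h) = \<xi> g * \<xi> h" if "g \<in> carrier G" "h \<in> carrier G" for g h
    using \<xi> that by (simp add: linear_character_def)
  have "\<xi> \<one> * \<xi> \<one> = \<xi> \<one>" using mult[of \<one> \<one>] by simp
  then have one: "\<xi> \<one> = 1" using nz[of \<one>] by simp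
  have inv: "\<xi> h * \<xi> (inv h) = 1" if "h \<in> carrier G" for h
    using mult[of h "inv h"] that one by simp
  have const: "\<xi> c = \<xi> g" if c: "c \<in> conj_class G g" for c
  proof -
    obtain h where h: "h \<in> carrier G" "c = h \<otimes> g \<otimes> inv h" using c unfolding conj_class_eq_image[OF g] by auto
    then have "\<xi> c = \<xi> g * (\<xi> h * \<xi> (inv h))" using g by (simp add: mult)
    then show ?thesis using inv[OF h(1)] by simp
  qed
  have "inv g \<in> conj_class G g"
    using conj_class_self[of "inv g"] g real by (simp add: inv_set_conj_class)
  then have ig: "\<xi> (inv g) = \<xi> g" by (rule const)
  then have "(\<xi> g)\<^sup>2 = 1" using inv[OF g] by (simp add: power2_eq_square)
  then have "\<xi> g = 1 \<or> \<xi> g = -1" by (simp add: power2_eq_1_iff)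
  moreover have "(\<forall>c\<in>conj_class G g. \<xi> c = -1) \<longleftrightarrow> \<xi> g = -1"
    using const conj_class_self[OF g] by metis
  ultimately show ?thesis using ig by (elim disjE) simp_all
qed

lemma n_R_xi_eq:
  assumes \<xi>: "linear_character G \<xi>"
  shows "real (n_R_xi G \<xi>) = real (card {C \<in> conj_classes G. C = inv_set G C}) - 2 * real (n_xi G \<xi>)"
proof -
  let ?N = "of_nat (card (carrier G)) :: complex"
  let ?A = "{C \<in> conj_classes G. C = inv_set G C}"
  \<comment> \<open>Extension by 0 off the carrier lets \<open>self_dual_xi\<close>, which only
    compares values on the carrier, be expressed as equality of functions.\<close>
  define dual where "dual \<chi> = (\<lambda>g. if g \<in> carrier G then cnj (\<chi> g) * \<xi> g else 0)" for \<chi>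
  have dual_Irr: "dual \<chi> \<in> Irr G" if "\<chi> \<in> Irr G" for \<chi>
    unfolding dual_def by (rule twisted_conjugate_Irr[OF that \<xi>])
  have self_dual: "self_dual_xi G \<xi> \<chi> \<longleftrightarrow> \<chi> = dual \<chi>" if "\<chi> \<in> Irr G" for \<chi>
  proof -
    have "\<chi> g = 0" if "g \<notin> carrier G" for g using \<open>\<chi> \<in> Irr G\<close> that by (auto simp: Irr_def character_def)
    then show ?thesis by (auto simp: self_dual_xi_def dual_def fun_eq_iff)
  qed
  have "?N * of_nat (n_R_xi G \<xi>) = (\<Sum>\<chi>\<in>Irr G. if self_dual_xi G \<xi> \<chi> then ?N else 0)"
    by (simp add: n_R_xi_def finite_Irr sum.If_cases Int_def)
  also have "\<dots> = (\<Sum>\<chi>\<in>Irr G. \<Sum>g\<in>carrier G. \<chi> g * dual \<chi> (inv g))"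
    by (intro sum.cong refl) (simp add: character_orthogonality dual_Irr self_dual)
  \<comment> \<open>The conjugate of \<open>\<chi> (inv g)\<close> is \<open>\<chi> g\<close> by
    \<open>Irr_inv\<close>. The square of \<open>\<chi> g\<close> is what makes column orthogonality
    count conjugators from \<open>g\<close> to \<open>inv g\<close>.\<close>
  also have "\<dots> = (\<Sum>\<chi>\<in>Irr G. \<Sum>g\<in>carrier G. \<chi> g * \<chi> g * \<xi> (inv g))"
    by (intro sum.cong refl) (simp add: dual_def Irr_inv)
  also have "\<dots> = (\<Sum>g\<in>carrier G. of_nat (card {h \<in> carrier G. h \<otimes> g \<otimes> inv h = inv g}) * \<xi> (inv g))"
    by (subst sum.swap) (simp add: column_orthogonality sum_distrib_right[symmetric])
  also have "\<dots> = ?N * (\<Sum>C\<in>?A. if \<forall>c\<in>C. \<xi> c = -1 then -1 else 1)"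
  proof (rule sum_card_conjugators)
    fix g assume g: "g \<in> carrier G"
    show "inv g \<in> conj_class G g \<longleftrightarrow> conj_class G g \<in> ?A"
      using g conj_class_eqI[OF g, of "inv g"] conj_class_self[of "inv g"]
      by (auto simp: conj_classes_def inv_set_conj_class)
    show "\<xi> (inv g) = (if \<forall>c\<in>conj_class G g. \<xi> c = -1 then -1 else 1)" if "conj_class G g \<in> ?A"
      using linear_character_real_class[OF \<xi> g] that by simp
  qed auto
  also have "(\<Sum>C\<in>?A. if \<forall>c\<in>C. \<xi> c = -1 then -1 else 1 :: complex)
      = (\<Sum>C\<in>?A. 1 - 2 * (if \<forall>c\<in>C. \<xi> c = -1 then 1 else 0))"
    by (intro sum.cong) auto
  also have "\<dots> = of_nat (card ?A) - 2 * of_nat (n_xi G \<xi>)"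
    by (simp add: sum_subtractf sum_distrib_left[symmetric] sum.If_cases n_xi_def Int_def conj_assoc)
  finally have "complex_of_real (real (n_R_xi G \<xi>)) = complex_of_real (real (card ?A) - 2 * real (n_xi G \<xi>))"
    using card_carrier_pos by (auto simp: card_gt_0_iff)
  then show ?thesis by (simp only: of_real_eq_iff)
qed

text \<open>A real class is its own union with its inverse, while the other classes fall into pairs
  with one union each. So \<open>n_starstar G\<close> exceeds the number of real classes by half of
  \<open>n_C G\<close>.\<close>

lemma n_R_eq: "n_R G = real (card {C \<in> conj_classes G. C = inv_set G C})"
proof -
  let ?A = "{C \<in> conj_classes G. C = inv_set G C}"
  let ?B = "{C \<in> conj_classes G. C \<noteq> inv_set G C}"
  let ?u = "\<lambda>C. C \<union> inv_set G C"
  let ?P = "(\<lambda>C. {C, inv_set G C}) ` ?B"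
  have "{conj_class G g \<union> conj_class G (inv g) | g. g \<in> carrier G} = ?u ` conj_classes G"
    by (auto simp: conj_classes_def inv_set_conj_class)
  also have "\<dots> = ?u ` ?A \<union> ?u ` ?B" by blast
  also have "?u ` ?A = ?A" by (auto simp: image_iff)
  finally have ss: "n_starstar G = card (?A \<union> ?u ` ?B)" by (simp add: n_starstar_def)
  \<comment> \<open>A class that is the union of \<open>D\<close> and its inverse meets
    \<open>D\<close>, hence equals \<open>D\<close>, and is then not real.\<close>
  have "C \<notin> ?u ` ?B" if "C \<in> ?A" for C
  proof
    assume "C \<in> ?u ` ?B"
    then obtain D where D: "D \<in> conj_classes G" "D \<noteq> inv_set G D" "C = D \<union> inv_set G D" by auto
    obtain x where "x \<in> D" using conj_classes_nonempty[OF D(1)] by auto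
    then have "C = D" using conj_classes_eq[of C D x] D that by auto
    then show False using that D by auto
  qed
  then have disj: "?A \<inter> ?u ` ?B = {}" by blast
  \<comment> \<open>Inversion is an involution without fixed points on the non-real classes, so its
    orbits are disjoint pairs.\<close>
  have "2 * card ?P = card (\<Union>?P)"
  proof (rule card_partition)
    have pair: "c = {x, inv_set G x}" if "c \<in> ?P" "x \<in> c" for c x
    proof -
      obtain C where C: "C \<in> conj_classes G" "c = {C, inv_set G C}" using \<open>c \<in> ?P\<close> by blast
      then have "x = C \<or> x = inv_set G C" using \<open>x \<in> c\<close> by simp
      then show ?thesis using C inv_set_involution[OF C(1)] by (elim disjE) (simp_all add: insert_commute)
    qed
    show "c1 \<inter> c2 = {}" if "c1 \<in> ?P" "c2 \<in> ?P" "c1 \<noteq> c2" for c1 c2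
    proof (rule ccontr)
      assume "c1 \<inter> c2 \<noteq> {}"
      then obtain x where x: "x \<in> c1" "x \<in> c2" by blast
      show False using pair[OF that(1) x(1)] pair[OF that(2) x(2)] that(3) by simp
    qed
    show "card c = 2" if "c \<in> ?P" for c
      using that by (auto simp: card_2_iff)
  qed (auto simp: inv_set_conj_classes)
  also have "\<Union>?P = ?B"
  proof -
    have "inv_set G C \<in> ?B" if "C \<in> ?B" for C
      using that inv_set_conj_classes[of C] inv_set_involution[of C] by auto
    then show ?thesis by blast
  qed
  also have "card ?P = card (?u ` ?B)"
  proof -
    \<comment> \<open>The union determines the pair, because a point of it lies in only one
      class.\<close>
    have "inj_on Union ?P"
    proof (rule inj_onI)
      fix p q assume "p \<in> ?P" "q \<in> ?P" and eq: "\<Union>p = \<Union>q"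
      then obtain C D where C: "C \<in> conj_classes G" "p = {C, inv_set G C}"
        and D: "D \<in> conj_classes G" "q = {D, inv_set G D}" by auto
      obtain x where "x \<in> C" using conj_classes_nonempty[OF C(1)] by auto
      then have "x \<in> D \<or> x \<in> inv_set G D" using eq C D by auto
      then have "C = D \<or> C = inv_set G D"
        using conj_classes_eq[OF C(1) _ \<open>x \<in> C\<close>] D(1) inv_set_conj_classes by blast
      then show "p = q" using C D inv_set_involution by auto
    qed
    then have "card (Union ` ?P) = card ?P" by (rule card_image)
    moreover have "Union ` ?P = ?u ` ?B" by (simp add: image_image)
    ultimately show ?thesis by simp
  qed
  finally have "2 * card (?u ` ?B) = n_C G" by (simp add: n_C_def)
  moreover have "n_starstar G = card ?A + card (?u ` ?B)"
    unfolding ss by (rule card_Un_disjoint) (use disj in auto)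
  ultimately show ?thesis unfolding n_R_def by (simp add: field_simps)
qed

end

theorem theorem3p9:
  fixes G :: "('g, 'b) monoid_scheme" and \<xi> :: "'g \<Rightarrow> complex"
  assumes "group G" and "finite (carrier G)" and "linear_character G \<xi>"
  shows "real (n_C G) / 2 + real (n_xi G \<xi>) = real (n_C_xi G \<xi>) / 2 \<and>
         n_R G - 2 * real (n_xi G \<xi>) = real (n_R_xi G \<xi>)"
proof -
  interpret finite_group G
    using assms by (simp add: finite_group_def finite_group_axioms_def)
  have "card {C \<in> conj_classes G. C = inv_set G C} + n_C G = card (conj_classes G)"
    unfolding n_C_def by (subst card_Un_disjoint[symmetric]) (auto intro: arg_cong[where f = card])
  moreover have "n_R_xi G \<xi> + n_C_xi G \<xi> = card (Irr G)"
    unfolding n_C_xi_def n_R_xi_def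
    by (subst card_Un_disjoint[symmetric]) (auto simp: finite_Irr intro: arg_cong[where f = card])
  \<comment> \<open>Real and non-real classes together match self-dual and other characters.
    Subtracting \<open>n_R_xi_eq\<close> leaves \<open>n_C_xi\<close> equal to \<open>n_C\<close>
    plus twice \<open>n_xi\<close>, the first identity doubled.\<close>
  ultimately have "real (n_R_xi G \<xi>) + real (n_C_xi G \<xi>)
      = real (card {C \<in> conj_classes G. C = inv_set G C}) + real (n_C G)"
    using card_Irr by linarith
  then show ?thesis using n_R_xi_eq[OF assms(3)] n_R_eq by simp
qed

end
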